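(* Let $\nu>-\tfrac12$, $p,q,\lambda>0$, and let $w$ be a weight function satisfying $\int_x^\infty\frac{w(t)}{t^3}dt=O\big(\frac{w(x)}{x^2}\big)$ as $x\to\infty$. Let $f\in E_{H_\nu}(p,q,\lambda,w)$. Then: (1) If $p\ge1$, there exist $l>0$ and $C>0$ such that for all $k\in\mathbb N_0$, $$|\langle f,\psi_k^\nu\rangle|\le C\,2^{2k}\,\Gamma(k+\nu+1)\,e^{2k\log q-\frac1l\varphi^*(2lk)},$$ where $\varphi(t)=w(e^t)$. (2) If $p<1$, there exist $l>0$ and $C>0$ such that for all $k\in\mathbb N_0$, $$|\langle f,\psi_k^\nu\rangle|\le C\,2^{2k}\,\Gamma(k+\nu+1)\,e^{2k\log q-\frac1l\zeta_{p,q}^*(2lk)},$$ where $\zeta_{p,q}(t)=\frac1{4q^2}\sqrt{\frac{1-p}{1+p}}\,e^{2t}+w(e^t)$.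
   Context: A weight function is an unbounded non-decreasing $w:[0,\infty)\to[0,\infty)$. Young conjugate: $\phi^*(v)=\sup_{u\ge0}[uv-\phi(u)]$. $J_\nu$ is the Bessel function; $\frac{J_\nu(z)}{z^\nu}=2^{-\nu}\sum_{k\ge0}\frac{(-1)^k}{k!\Gamma(k+\nu+1)}(z/2)^{2k}$ (entire). Hankel transform: $H_\nu f(s)=\int_0^\infty f(r)\frac{J_\nu(sr)}{(sr)^\nu}r^{2\nu+1}dr$. For $p,q,\lambda>0$, $E_{H_\nu}(p,q,\lambda,w)$ is the set of $f\in(L^1\cap L^2)(\mathbb R^+,r^{2\nu+1}dr)$ such that for some $C>0$, $|f(r)|\le Ce^{-pr^2/2+\lambda w(qr)}$ and $|H_\nu f(s)|\le Ce^{-ps^2/2+\lambda w(qs)}$ for all $r,s>0$. Laguerre functions $\psi_k^\nu(s)=L_k^\nu(s^2)e^{-s^2/2}$, with $L_k^\nu$ the Laguerre polynomials of type $\nu$ ($\sum_kL_k^\nu(x)r^k=(1-r)^{-\nu-1}e^{-xr/(1-r)}$). $\langle f,g\rangle=\int_0^\infty f(r)\overline{g(r)}r^{2\nu+1}dr$. *)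

theory Defs
  imports "HOL-Analysis.Analysis" "HOL-Library.Landau_Symbols"
begin

definition weight_function :: "(real \<Rightarrow> real) \<Rightarrow> bool" where
  "weight_function w \<longleftrightarrow> (\<forall>t\<ge>0. w t \<ge> 0) \<and> mono_on {0..} w \<and> (\<forall>M. \<exists>t\<ge>0. w t > M)"

text \<open>Young conjugate, valued in the extended reals (it may be +infinity).\<close>
definition young_conj :: "(real \<Rightarrow> real) \<Rightarrow> real \<Rightarrow> ereal" where
  "young_conj \<phi> v = (SUP u\<in>{0..}. ereal (u * v - \<phi> u))"

definition eexp :: "ereal \<Rightarrow> ereal" where
  "eexp x = (if x = \<infinity> then \<infinity> else if x = - \<infinity> then 0 else ereal (exp (real_of_ereal x)))"

text \<open>The entire function J_nu(z)/z^nu, via its power series.\<close>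
definition bessel_norm :: "real \<Rightarrow> real \<Rightarrow> real" where
  "bessel_norm \<nu> z = 2 powr (-\<nu>) *
     (\<Sum>k. (-1)^k / (fact k * Gamma (real k + \<nu> + 1)) * (z / 2) ^ (2 * k))"

definition hankel :: "real \<Rightarrow> (real \<Rightarrow> complex) \<Rightarrow> real \<Rightarrow> complex" where
  "hankel \<nu> f s = (LINT r:{0<..}|lborel. (bessel_norm \<nu> (s * r) * r powr (2 * \<nu> + 1)) *\<^sub>R f r)"

definition hinner :: "real \<Rightarrow> (real \<Rightarrow> complex) \<Rightarrow> (real \<Rightarrow> complex) \<Rightarrow> complex" where
  "hinner \<nu> f g = (LINT r:{0<..}|lborel. (r powr (2 * \<nu> + 1)) *\<^sub>R (f r * cnj (g r)))"

definition L1L2 :: "real \<Rightarrow> (real \<Rightarrow> complex) \<Rightarrow> bool" where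
  "L1L2 \<nu> f \<longleftrightarrow>
     set_integrable lborel {0<..} (\<lambda>r. (r powr (2 * \<nu> + 1)) *\<^sub>R f r) \<and>
     set_borel_measurable lborel {0<..} f \<and>
     set_integrable lborel {0<..} (\<lambda>r. r powr (2 * \<nu> + 1) * (cmod (f r))^2)"

definition E_H :: "real \<Rightarrow> real \<Rightarrow> real \<Rightarrow> real \<Rightarrow> (real \<Rightarrow> real) \<Rightarrow> (real \<Rightarrow> complex) set" where
  "E_H \<nu> p q lam w = {f. L1L2 \<nu> f \<and> (\<exists>C>0.
      (\<forall>r>0. cmod (f r) \<le> C * exp (- p * r^2 / 2 + lam * w (q * r))) \<and>
      (\<forall>s>0. cmod (hankel \<nu> f s) \<le> C * exp (- p * s^2 / 2 + lam * w (q * s))))}"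

text \<open>Laguerre polynomials of type nu (explicit formula, equivalent to the generating function
  sum_k L_k(x) r^k = (1-r)^(-nu-1) exp(-x r/(1-r))).\<close>
definition laguerre :: "nat \<Rightarrow> real \<Rightarrow> real \<Rightarrow> real" where
  "laguerre k \<nu> x = (\<Sum>j\<le>k. (-1)^j * Gamma (real k + \<nu> + 1) /
      (Gamma (real j + \<nu> + 1) * fact (k - j) * fact j) * x ^ j)"

definition laguerre_fun :: "real \<Rightarrow> nat \<Rightarrow> real \<Rightarrow> complex" where
  "laguerre_fun \<nu> k s = complex_of_real (laguerre k \<nu> (s^2) * exp (- (s^2) / 2))"

end

theory Submission
  imports Defs "HOL-Complex_Analysis.Complex_Analysis" "HOL-Probability.Distributions"
    "HOL-Real_Asymp.Real_Asymp"
begin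

text \<open>
  Let a(k) be the Laguerre coefficients of f. The entire function with Taylor coefficients
  a(k) / Gamma(k + \<nu> + 1) is, by the generating function of the Laguerre polynomials, a
  Bargmann-type integral transform of f with Bessel kernel; Weber's second exponential integral
  expresses it equally through the Hankel transform of f. For p \<ge> 1 the two representations at
  (x + iy)^2 / 4 give bounds by exp(x^2/4 + \<lambda> w(q|y|)) and exp(y^2/4 + \<lambda> w(q|x|)). The
  integral condition on w forces w(t) \<le> D w(x) (t/x)^a for t \<ge> x with some a < 2, so on every
  quadrant the weight can be divided out by a holomorphic function and a Phragmen--Lindelof
  argument bounds the transform by exp(L w(q|z|)). Cauchy's estimate on the circle
  |z| = exp(u)/q, optimized over u \<ge> 0, produces the Young conjugate. For p < 1 the crude bound
  exp(3|z|^2/4) already suffices, because l may be chosen small.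
\<close>

subsection \<open>Growth of the weight\<close>

text \<open>In a quadrant, of opening pi/2, order 2 is the critical growth for the
  Phragmen--Lindelof principle, and the transform may have exactly that order. Bounds on the two
  edges alone would not suffice: exp(-i c z^2) has modulus 1 on the edges and exp(2 c x y) inside,
  where z = x + iy. What helps is that two bounds hold in the whole quadrant, one of them good near
  each edge. The form of these bounds comes from putting t = z^2/4. The kernel becomes an even
  entire function of r z of growth exp(r|y|), the integral against the Gaussians in r produces
  exp(y^2/4 + \<lambda> w(q|y|)), and the factor in front has |exp t| = exp((x^2 - y^2)/4). Passing
  to the Hankel transform replaces t by -t, that is z by iz, and thereby exchanges x and y. Every
  loss in the treatment of the weight is a constant factor in front of w, and such a factor is
  absorbed by the free parameter l of the conclusion.\<close>

lemma weight_function_nonneg: "weight_function w \<Longrightarrow> 0 \<le> t \<Longrightarrow> 0 \<le> w t"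
  by (simp add: weight_function_def)

lemma weight_function_mono: "weight_function w \<Longrightarrow> 0 \<le> s \<Longrightarrow> s \<le> t \<Longrightarrow> w s \<le> w t"
  by (auto simp: weight_function_def mono_on_def)

text \<open>By monotonicity the integrand is at least \<open>w x / (2*x)^3\<close> on the interval
  from x to 2x, which has length x. Doubling x therefore lowers the tail integral by a definite
  amount.\<close>

lemma weight_tail_integral_step:
  fixes w :: "real \<Rightarrow> real"
  assumes w: "weight_function w" and x: "x > 0"
    and int: "set_integrable lborel {x..} (\<lambda>t. w t / t^3)"
  shows "(LINT t:{2*x..}|lborel. w t / t^3) + w x / (8 * x^2) \<le> (LINT t:{x..}|lborel. w t / t^3)"
    and "0 \<le> (LINT t:{x..}|lborel. w t / t^3)"
proof -
  have i1: "set_integrable lborel {x..<2*x} (\<lambda>t. w t / t^3)"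
    by (rule set_integrable_subset[OF int]) auto
  have i2: "set_integrable lborel {2*x..} (\<lambda>t. w t / t^3)"
    by (rule set_integrable_subset[OF int]) (use x in auto)
  have "(LINT t:{x..}|lborel. w t / t^3) = (LINT t:{x..<2*x} \<union> {2*x..}|lborel. w t / t^3)"
    using x by (intro arg_cong2[where f = "set_lebesgue_integral lborel"]) auto
  also have "\<dots> = (LINT t:{x..<2*x}|lborel. w t / t^3) + (LINT t:{2*x..}|lborel. w t / t^3)"
    by (rule set_integral_Un[OF _ i1 i2]) auto
  finally have eq: "(LINT t:{x..}|lborel. w t / t^3) = \<dots>" .
  have "(LINT t:{x..<2*x}|lborel. w x / (2*x)^3) \<le> (LINT t:{x..<2*x}|lborel. w t / t^3)"
  proof (rule set_integral_mono[OF _ i1])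
    show "set_integrable lborel {x..<2*x} (\<lambda>t. w x / (2*x)^3)"
      unfolding set_integrable_def by (intro integrable_scaleR_left integrable_real_indicator) (use x in auto)
    show "w x / (2*x)^3 \<le> w t / t^3" if "t \<in> {x..<2*x}" for t
      using that x by (intro frac_le power_mono weight_function_mono[OF w] weight_function_nonneg[OF w]) auto
  qed
  also have "(LINT t:{x..<2*x}|lborel. w x / (2*x)^3) = w x / (8 * x^2)"
    using x by (simp add: set_lebesgue_integral_def power2_eq_square power3_eq_cube field_simps)
  finally show "(LINT t:{2*x..}|lborel. w t / t^3) + w x / (8 * x^2) \<le> (LINT t:{x..}|lborel. w t / t^3)"
    using eq by simp
  show "0 \<le> (LINT t:{x..}|lborel. w t / t^3)"
    unfolding set_lebesgue_integral_def
    using x by (intro Bochner_Integration.integral_nonneg)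
      (auto simp: indicator_def intro!: divide_nonneg_nonneg weight_function_nonneg[OF w])
qed

text \<open>Write I for the tail integral. The O-bound makes the drop of I under doubling a fixed
  proportion of I itself, so I decays geometrically with ratio \<theta> < 1. Since w(x) is at most 8
  x^2 I(x), each doubling multiplies the bound for w by 4\<theta> < 4, and the exponent log 2
  (4\<theta>) stays below 2.\<close>

lemma weight_function_power_growth:
  fixes w :: "real \<Rightarrow> real"
  assumes w: "weight_function w"
    and wint: "\<forall>\<^sub>F x in at_top. set_integrable lborel {x..} (\<lambda>t. w t / t^3)"
    and wO: "(\<lambda>x. LINT t:{x..}|lborel. w t / t^3) \<in> O[at_top](\<lambda>x. w x / x^2)"
  obtains D a x\<^sub>0 where "D \<ge> 1" "0 < a" "a < 2" "x\<^sub>0 > 0"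
    "\<And>x t. x\<^sub>0 \<le> x \<Longrightarrow> x \<le> t \<Longrightarrow> w t \<le> D * w x * (t / x) powr a"
proof -
  define I where "I = (\<lambda>x. LINT t:{x..}|lborel. w t / t^3)"
  from wO obtain c where c: "\<forall>\<^sub>F x in at_top. norm (I x) \<le> c * norm (w x / x^2)"
    unfolding I_def by (auto elim: landau_o.bigE)
  \<comment> \<open>The lower bound 1 places \<theta> in [7/8, 1), hence 4\<theta> > 1 and the
    exponent a is positive.\<close>
  define K where "K = max c 1"
  have "\<forall>\<^sub>F x in at_top. x > 0 \<and> set_integrable lborel {x..} (\<lambda>t. w t / t^3) \<and> norm (I x) \<le> c * norm (w x / x^2)"
    using wint c eventually_gt_at_top[of 0] by eventually_elim auto
  then obtain x0 where x0: "\<And>x. x \<ge> x0 \<Longrightarrow> x > 0 \<and> set_integrable lborel {x..} (\<lambda>t. w t / t^3) \<and> norm (I x) \<le> c * norm (w x / x^2)"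
    by (auto simp: eventually_at_top_linorder)
  have "x0 > 0" using x0[of x0] by simp
  have K: "K \<ge> 1" "c \<le> K" by (auto simp: K_def)
  have IK: "I x \<le> K * (w x / x^2)" if "x \<ge> x0" for x
  proof -
    have "I x \<le> c * norm (w x / x^2)" using x0[OF that] by (metis abs_le_D1 real_norm_def)
    also have "norm (w x / x^2) = w x / x^2"
      using x0[OF that] weight_function_nonneg[OF w, of x] by simp
    also have "c * (w x / x^2) \<le> K * (w x / x^2)"
      using K weight_function_nonneg[OF w, of x] x0[OF that] by (intro mult_right_mono) auto
    finally show ?thesis .
  qed
  have step: "I (2*x) + w x / (8*x^2) \<le> I x" "0 \<le> I x" if "x \<ge> x0" for x
    using weight_tail_integral_step[OF w, of x] x0[OF that] by (auto simp: I_def)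
  define \<theta> where "\<theta> = 1 - 1 / (8*K)"
  have \<theta>: "\<theta> \<ge> 7/8" "\<theta> < 1"
    using K by (auto simp: \<theta>_def field_simps)
  have I2: "I (2*x) \<le> \<theta> * I x" if "x \<ge> x0" for x
  proof -
    have "I x / (8*K) \<le> w x / (8*x^2)"
      using IK[OF that] K by (simp add: field_simps)
    with step(1)[OF that] show ?thesis by (simp add: \<theta>_def algebra_simps)
  qed
  have In: "I (2^n*x) \<le> \<theta>^n * I x" if "x \<ge> x0" for x n
  proof (induction n)
    case (Suc n)
    have ge: "2^n*x \<ge> x0" using that \<open>x0 > 0\<close> mult_mono[of 1 "2^n" x0 x] by simp
    have "I (2^Suc n*x) \<le> \<theta> * I (2^n*x)" using I2[OF ge] by (simp add: mult.assoc)
    also have "\<dots> \<le> \<theta> * (\<theta>^n * I x)" using Suc \<theta> by (intro mult_left_mono) auto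
    finally show ?case by simp
  qed simp
  define a where "a = log 2 (4*\<theta>)"
  have a2: "2 powr a = 4 * \<theta>" using \<theta> by (simp add: a_def)
  have wn: "w (2^n*x) \<le> 8 * K * (4*\<theta>)^n * w x" if "x \<ge> x0" for x n
  proof -
    have ge: "2^n*x \<ge> x0" using that \<open>x0 > 0\<close> mult_mono[of 1 "2^n" x0 x] by simp
    have ge2: "2*(2^n*x) \<ge> x0" using ge \<open>x0 > 0\<close> by simp
    have "w (2^n*x) / (8*(2^n*x)^2) \<le> I (2^n*x)" using step(1)[OF ge] step(2)[OF ge2] by simp
    also have "\<dots> \<le> \<theta>^n * I x" by (rule In[OF that])
    also have "\<dots> \<le> \<theta>^n * (K * (w x / x^2))" using IK[OF that] \<theta> by (intro mult_left_mono) auto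
    finally have "w (2^n*x) \<le> \<theta>^n * (K * (w x / x^2)) * (8*(2^n*x)^2)"
      using x0[OF that] by (simp add: pos_divide_le_eq)
    also have "\<dots> = 8 * K * (4*\<theta>)^n * w x"
      using x0[OF that] by (simp add: power_mult_distrib field_simps flip: power_mult)
        (simp add: power_mult mult.commute[of n 2])
    finally show ?thesis .
  qed
  show thesis
  \<comment> \<open>The extra factor 4\<theta> pays for rounding log 2 (t/x) up to the next
    integer.\<close>
  proof (rule that[of "8*K*(4*\<theta>)" a x0])
    show "1 \<le> 8 * K * (4*\<theta>)" using K \<theta> mult_mono[of 1 K "1/32" "\<theta>"] by simp
    show "0 < a" "a < 2" using \<theta> by (auto simp: a_def log_less_iff)
    show "0 < x0" by fact
    fix x t assume x: "x0 \<le> x" "x \<le> t"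
    have "x > 0" using x \<open>x0 > 0\<close> by simp
    define n where "n = nat \<lfloor>log 2 (t/x)\<rfloor>"
    have tx: "t/x \<ge> 1" using x \<open>x > 0\<close> by simp
    have l0: "log 2 (t/x) \<ge> 0" using tx by (simp add: zero_le_log_cancel_iff)
    have "real n \<le> log 2 (t/x)" "log 2 (t/x) \<le> real (Suc n)"
      using l0 unfolding n_def by (auto, linarith+)
    then have n: "2 powr real n \<le> t/x" "t/x \<le> 2 powr real (Suc n)"
      using tx by (auto simp: le_log_iff log_le_iff simp del: of_nat_Suc)
    have "w t \<le> w (2^Suc n * x)"
      using n(2) x \<open>x>0\<close> by (intro weight_function_mono[OF w]) (auto simp: powr_realpow field_simps powr_add)
    also have "\<dots> \<le> 8 * K * (4*\<theta>)^Suc n * w x" by (rule wn[OF x(1)])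
    also have "\<dots> = 8*K*(4*\<theta>) * w x * (2 powr real n) powr a"
    proof -
      have "(2 powr real n) powr a = (2 powr a) ^ n"
        by (simp add: powr_powr powr_realpow[symmetric] mult.commute)
      then show ?thesis by (simp add: a2)
    qed
    also have "\<dots> \<le> 8*K*(4*\<theta>) * w x * (t/x) powr a"
      using n(1) K \<theta> \<open>x>0\<close> \<open>0<a\<close> weight_function_nonneg[OF w, of x]
      by (intro mult_left_mono powr_mono2) auto
    finally show "w t \<le> 8*K*(4*\<theta>) * w x * (t/x) powr a" .
  qed
qed

text \<open>A power with exponent a < 2 is o(t^2). The result lets a small part of a Gaussian absorb
  the weight in the tail of the transform integral.\<close>

lemma weight_function_quadratic_bound:
  fixes w :: "real \<Rightarrow> real"
  assumes w: "weight_function w" and D: "D \<ge> 1" "0 < a" "a < 2" "x\<^sub>0 > 0"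
    and gr: "\<And>x t. x\<^sub>0 \<le> x \<Longrightarrow> x \<le> t \<Longrightarrow> w t \<le> D * w x * (t / x) powr a"
    and e: "e > 0"
  obtains K where "\<And>t. t \<ge> 0 \<Longrightarrow> w t \<le> e * t^2 + K"
proof -
  have "\<forall>\<^sub>F t::real in at_top. D * w x\<^sub>0 * (t / x\<^sub>0) powr a \<le> e * t^2"
    using e D by real_asymp
  then obtain T where T: "\<And>t. t \<ge> T \<Longrightarrow> D * w x\<^sub>0 * (t / x\<^sub>0) powr a \<le> e * t^2"
    by (auto simp: eventually_at_top_linorder)
  define S where "S = max T x\<^sub>0"
  show thesis
  proof (rule that[of "w S"])
    fix t :: real assume t: "t \<ge> 0"
    show "w t \<le> e * t^2 + w S"
    proof (cases "t \<le> S")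
      case True
      then have "w t \<le> w S" by (rule weight_function_mono[OF w t])
      then show ?thesis using e by (simp add: add_increasing)
    next
      case False
      then have "w t \<le> D * w x\<^sub>0 * (t / x\<^sub>0) powr a" by (intro gr) (auto simp: S_def)
      also have "\<dots> \<le> e * t^2" using False by (intro T) (auto simp: S_def)
      finally show ?thesis using weight_function_nonneg[OF w, of S] D by (force simp: S_def)
    qed
  qed
qed

subsection \<open>A Phragmen--Lindelof principle in a quadrant\<close>

text \<open>The argument of the power is at most \<open>a * arctan \<sigma>\<close> < pi/2 in
  absolute value, and cosine decreases there. Such powers serve twice: as exponents of damping
  factors, and as holomorphic majorants of the weight.\<close>

lemma Re_powr_ge_sector:
  fixes z :: complex
  assumes "Re z > 0" "\<bar>Im z\<bar> \<le> \<sigma> * Re z" "0 < a" "a * arctan \<sigma> < pi/2"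
  shows "Re (z powr of_real a) \<ge> cos (a * arctan \<sigma>) * cmod z powr a"
proof -
  have z: "z \<noteq> 0" using assms by auto
  have Arg: "Arg z = arctan (Im z / Re z)" using assms by (simp add: arg_conv_arctan Arg_eq)
  have "\<bar>Im z / Re z\<bar> \<le> \<sigma>" using assms by (simp add: field_simps)
  then have "\<bar>Arg z\<bar> \<le> arctan \<sigma>"
    unfolding Arg abs_le_iff using arctan_monotone' arctan_minus by (metis minus_le_iff)
  then have le: "\<bar>a * Arg z\<bar> \<le> a * arctan \<sigma>" using assms by (simp add: abs_mult)
  have "cos (a * arctan \<sigma>) \<le> cos \<bar>a * Arg z\<bar>"
    using le assms by (intro cos_monotone_0_pi_le) auto
  then have c: "cos (a * arctan \<sigma>) \<le> cos (a * Arg z)" by simp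
  have "Re (z powr of_real a) = exp (a * ln (cmod z)) * cos (a * Arg z)"
    using z by (simp add: powr_def Re_exp Arg_def)
  also have "exp (a * ln (cmod z)) = cmod z powr a" using z by (simp add: powr_def)
  finally show ?thesis using c by (simp add: mult.commute mult_left_mono)
qed

text \<open>The factor exp(i \<tau> z^2 / 8) has modulus exp(-\<tau> x y / 4). On the ray y = \<tau>
  x the second bound is C exp(y^2/4) = C exp(\<tau> x y / 4), so the product is bounded by C there,
  and likewise on x = \<tau> y. The sector between these rays has opening less than pi/2, where
  growth of order 2 is subcritical and the classical argument applies. As \<tau> tends to 0 the
  sector exhausts the open quadrant and the factor disappears.\<close>

lemma Phragmen_Lindelof_quadrant:
  fixes G :: "complex \<Rightarrow> complex"
  assumes hol: "G holomorphic_on U" and U: "open U" "{z. 0 \<le> Re z \<and> 0 \<le> Im z} \<subseteq> U"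
    and bx: "\<And>z. 0 \<le> Re z \<Longrightarrow> 0 \<le> Im z \<Longrightarrow> cmod (G z) \<le> C * exp ((Re z)^2 / 4)"
    and b\<^sub>y: "\<And>z. 0 \<le> Re z \<Longrightarrow> 0 \<le> Im z \<Longrightarrow> cmod (G z) \<le> C * exp ((Im z)^2 / 4)"
    and z: "0 \<le> Re z" "0 \<le> Im z"
  shows "cmod (G z) \<le> C"
proof (cases "Re z = 0 \<or> Im z = 0")
  case True
  then show ?thesis using bx[OF z] b\<^sub>y[OF z] by auto
next
  case False
  then have z0: "0 < Re z" "0 < Im z" using z by auto
  define x0 where "x0 = Re z"
  define y0 where "y0 = Im z"
  have xy: "0 < x0" "0 < y0" using z0 by (auto simp: x0_def y0_def)
  have C: "C \<ge> 0" using bx[OF z] by (smt (verit) exp_gt_zero mult_neg_pos norm_ge_zero)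
  have key: "cmod (G z) \<le> C * exp (\<tau> / 4 * (x0*y0))"
    if \<tau>: "0 < \<tau>" "\<tau> < 1" "\<tau> * x0 \<le> y0" "\<tau> * y0 \<le> x0" for \<tau>
  proof -
    \<comment> \<open>Multiplication by 1 - i sends x + iy to (x + y) + i (y - x); \<sigma> is the
      absolute slope of the images of the two bounding rays.\<close>
    define \<sigma> where "\<sigma> = (1 - \<tau>) / (1 + \<tau>)"
    have \<sigma>: "0 < \<sigma>" "\<sigma> < 1" using \<tau> by (auto simp: \<sigma>_def)
    define \<delta> where "\<delta> = arctan \<sigma>"
    have \<delta>: "0 < \<delta>" "\<delta> < pi/4"
      using \<sigma> arctan_monotone[of \<sigma> 1] by (auto simp: \<delta>_def arctan_one)
    \<comment> \<open>The mean of 2 and pi/(2\<delta>): larger than 2, so that the damping beats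
      |z|^2, and small enough for \<beta>\<delta> < pi/2.\<close>
    define \<beta> where "\<beta> = 1 + pi / (4*\<delta>)"
    have \<beta>: "\<beta> > 2" using \<delta> by (simp add: \<beta>_def field_simps)
    have \<beta>\<delta>: "\<beta> * \<delta> < pi/2" using \<delta> by (simp add: \<beta>_def field_simps)
    define \<kappa> where "\<kappa> = cos (\<beta> * \<delta>)"
    have \<kappa>: "\<kappa> > 0" using \<beta>\<delta> \<beta> \<delta> unfolding \<kappa>_def by (intro cos_gt_zero_pi) (auto intro: less_trans[of _ 0])
    define S where "S = {z. 0 \<le> Re z \<and> 0 \<le> Im z \<and> \<tau> * Re z \<le> Im z \<and> \<tau> * Im z \<le> Re z}"
    \<comment> \<open>The factor 1 - i brings the bisector of the quadrant to the positive real
      axis; adding 1 keeps the branch point of the power away from the closed sector, vertex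
      included.\<close>
    define rot where "rot = (\<lambda>z::complex. 1 + Complex 1 (-1) * z)"
    have rot_Re: "Re (rot z) = 1 + Re z + Im z" "Im (rot z) = Im z - Re z" for z
      by (auto simp: rot_def)
    have rotS: "Re (rot z) > 0" "\<bar>Im (rot z)\<bar> \<le> \<sigma> * Re (rot z)" "cmod (rot z) \<ge> cmod z" if "z \<in> S" for z
    proof -
      show "Re (rot z) > 0" using that by (auto simp: S_def rot_Re)
      have "(1+\<tau>) * \<bar>Im z - Re z\<bar> \<le> (1 - \<tau>) * (Re z + Im z)"
        using that by (auto simp: S_def algebra_simps abs_if)
      also have "\<dots> \<le> (1 - \<tau>) * (1 + Re z + Im z)" using \<tau> by (intro mult_left_mono) auto
      finally show "\<bar>Im (rot z)\<bar> \<le> \<sigma> * Re (rot z)"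
        using \<tau> by (simp add: rot_Re \<sigma>_def field_simps)
      have "(cmod z)^2 \<le> (cmod (rot z))^2"
        using that unfolding cmod_power2 rot_Re S_def
        by (auto simp: power2_eq_square algebra_simps intro!: add_nonneg_nonneg)
      then show "cmod (rot z) \<ge> cmod z" using power2_le_imp_le norm_ge_zero by blast
    qed
    have Rep: "\<kappa> * cmod z powr \<beta> \<le> Re (rot z powr of_real \<beta>)" if "z \<in> S" for z
    proof -
      have "\<kappa> * cmod z powr \<beta> \<le> \<kappa> * cmod (rot z) powr \<beta>"
        using rotS(3)[OF that] \<kappa> \<beta> by (intro mult_left_mono powr_mono2) auto
      also have "\<dots> \<le> Re (rot z powr of_real \<beta>)"
        unfolding \<kappa>_def \<delta>_def using rotS[OF that] \<beta> \<beta>\<delta> \<delta>_def by (intro Re_powr_ge_sector) auto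
      finally show ?thesis .
    qed
    have zS: "z \<in> S" using that xy by (auto simp: S_def x0_def y0_def)
    \<comment> \<open>The factor exp(-\<epsilon> \<open>rot z powr \<beta>\<close>) beats the crude
      growth exp(\<rho>^2/4) on a distant arc, so the maximum principle on the truncated sector
      gives the bound C. Afterwards \<epsilon> tends to 0 at the fixed point z.\<close>
    have eps: "cmod (G z * exp (\<i> * of_real (\<tau>/8) * z^2)) \<le> C * exp (\<epsilon> * Re (rot z powr of_real \<beta>))"
      if "\<epsilon> > 0" for \<epsilon> :: real
    proof -
      define H where "H = (\<lambda>z. G z * exp (\<i> * of_real (\<tau>/8) * z^2) * exp (- of_real \<epsilon> * rot z powr of_real \<beta>))"
      have normE: "cmod (exp (\<i> * of_real (\<tau>/8) * z^2)) = exp (- (\<tau>/4 * (Re z * Im z)))" for z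
        by (simp add: norm_exp_eq_Re power2_eq_square)
      have normH: "cmod (H z) = cmod (G z) * exp (- (\<tau>/4 * (Re z * Im z))) * exp (- \<epsilon> * Re (rot z powr of_real \<beta>))" for z
        unfolding H_def norm_mult normE by (simp add: norm_exp_eq_Re)
      have "\<forall>\<^sub>F \<rho>::real in at_top. \<rho>^2/4 \<le> \<epsilon> * (\<kappa> * \<rho> powr \<beta>)"
        using \<beta> \<kappa> that by real_asymp
      then have "\<forall>\<^sub>F \<rho>::real in at_top. \<rho>^2/4 \<le> \<epsilon> * (\<kappa> * \<rho> powr \<beta>) \<and> \<rho> > cmod z"
        using eventually_gt_at_top[of "cmod z"] by eventually_elim auto
      then obtain \<rho> where \<rho>: "\<rho>^2/4 \<le> \<epsilon> * (\<kappa> * \<rho> powr \<beta>)" "\<rho> > cmod z"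
        by (auto simp: eventually_at_top_linorder)
      define T where "T = S \<inter> cball 0 \<rho>"
      have clS: "closed S" unfolding S_def
        by (intro closed_Collect_conj closed_Collect_le continuous_intros)
      then have clT: "closed T" unfolding T_def by auto
      have SU: "S \<subseteq> U" using U(2) by (auto simp: S_def)
      have holH: "H holomorphic_on T"
        unfolding H_def
      proof (intro holomorphic_intros)
        show "G holomorphic_on T" using hol SU T_def by (auto intro: holomorphic_on_subset)
        show "rot holomorphic_on T" unfolding rot_def by (intro holomorphic_intros)
        show "rot z \<notin> \<real>\<^sub>\<le>\<^sub>0" if "z \<in> T" for z
          using rotS(1)[of z] that by (auto simp: T_def complex_nonpos_Reals_iff)
      qed
      have "cmod (H z) \<le> C"
      proof (rule maximum_modulus_frontier[of H T])
        show "H holomorphic_on interior T" using holH interior_subset holomorphic_on_subset by blast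
        show "continuous_on (closure T) H" using clT holH by (simp add: holomorphic_on_imp_continuous_on)
        show "bounded T" unfolding T_def by (intro bounded_Int) simp
        show "z \<in> T" using zS \<rho> by (simp add: T_def)
        fix u assume u: "u \<in> frontier T"
        then have uT: "u \<in> T" using frontier_subset_closed[OF clT] by blast
        then have uS: "u \<in> S" by (simp add: T_def)
        then have un: "0 \<le> Re u" "0 \<le> Im u" by (auto simp: S_def)
        have "\<epsilon> * (\<kappa> * cmod u powr \<beta>) \<le> \<epsilon> * Re (rot u powr of_real \<beta>)"
          using Rep[OF uS] that by (intro mult_left_mono) auto
        then have e1: "exp (- \<epsilon> * Re (rot u powr of_real \<beta>)) \<le> exp (- (\<epsilon> * (\<kappa> * cmod u powr \<beta>)))"
          by simp
        have "u \<notin> interior T" using u by (simp add: frontier_def)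
        moreover have "open {z. 0 < Re z \<and> 0 < Im z \<and> \<tau> * Re z < Im z \<and> \<tau> * Im z < Re z \<and> cmod z < \<rho>}"
          by (intro open_Collect_conj open_Collect_less continuous_intros)
        moreover have "{z. 0 < Re z \<and> 0 < Im z \<and> \<tau> * Re z < Im z \<and> \<tau> * Im z < Re z \<and> cmod z < \<rho>} \<subseteq> T"
          by (auto simp: T_def S_def)
        ultimately have "\<not> (0 < Re u \<and> 0 < Im u \<and> \<tau> * Re u < Im u \<and> \<tau> * Im u < Re u \<and> cmod u < \<rho>)"
          using interior_maximal by blast
        moreover have "cmod u \<le> \<rho>" using uT by (simp add: T_def)
        moreover have "0 \<le> \<tau> * Re u" "0 \<le> \<tau> * Im u" using un \<tau> by auto
        \<comment> \<open>Inside S the first two alternatives occur only at the vertex. The next two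
          are the slanted edges, the last one is the arc.\<close>
        ultimately consider "Re u = 0" | "Im u = 0" | "Im u = \<tau> * Re u" | "Re u = \<tau> * Im u" | "cmod u = \<rho>"
          using un uS by (fastforce simp: S_def)
        then have "cmod (G u) * exp (- (\<tau>/4 * (Re u * Im u))) * exp (- (\<epsilon> * (\<kappa> * cmod u powr \<beta>))) \<le> C"
        proof (cases)
          case 5
          have "(Re u)^2 \<le> \<rho>^2" using 5 complex_Re_le_cmod[of u] un by (intro power_mono) auto
          then have "cmod (G u) \<le> C * exp (\<rho>^2/4)" using bx[OF un] C by (smt (verit) exp_le_cancel_iff mult_left_mono divide_right_mono)
          then have "cmod (G u) * exp (- (\<tau>/4 * (Re u * Im u))) * exp (- (\<epsilon> * (\<kappa> * cmod u powr \<beta>)))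
              \<le> (C * exp (\<rho>^2/4)) * 1 * exp (- (\<epsilon> * (\<kappa> * cmod u powr \<beta>)))"
            using \<tau> un C by (intro mult_mono) auto
          also have "\<dots> = C * exp (\<rho>^2/4 - \<epsilon> * (\<kappa> * \<rho> powr \<beta>))" by (simp add: 5 flip: exp_add)
          also have "\<dots> \<le> C * 1" using \<rho> C by (intro mult_left_mono) auto
          finally show ?thesis by simp
        next
          case 1
          have "cmod (G u) \<le> C" using bx[OF un] 1 by simp
          then have "cmod (G u) * exp (- (\<tau>/4 * (Re u * Im u))) * exp (- (\<epsilon> * (\<kappa> * cmod u powr \<beta>))) \<le> C * 1 * 1"
            using \<tau> un C that \<kappa> by (intro mult_mono) auto
          then show ?thesis by simp
        next
          case 2
          have "cmod (G u) \<le> C" using b\<^sub>y[OF un] 2 by simp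
          then have "cmod (G u) * exp (- (\<tau>/4 * (Re u * Im u))) * exp (- (\<epsilon> * (\<kappa> * cmod u powr \<beta>))) \<le> C * 1 * 1"
            using \<tau> un C that \<kappa> by (intro mult_mono) auto
          then show ?thesis by simp
        next
          case 3
          have "cmod (G u) * exp (- (\<tau>/4 * (Re u * Im u))) * exp (- (\<epsilon> * (\<kappa> * cmod u powr \<beta>)))
              \<le> (C * exp ((Im u)^2/4)) * exp (- (\<tau>/4 * (Re u * Im u))) * 1"
            using \<tau> un C that \<kappa> b\<^sub>y[OF un] by (intro mult_mono) auto
          also have "\<dots> = C" by (simp add: exp_minus 3 power2_eq_square field_simps)
          finally show ?thesis by simp
        next
          case 4
          have "cmod (G u) * exp (- (\<tau>/4 * (Re u * Im u))) * exp (- (\<epsilon> * (\<kappa> * cmod u powr \<beta>)))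
              \<le> (C * exp ((Re u)^2/4)) * exp (- (\<tau>/4 * (Re u * Im u))) * 1"
            using \<tau> un C that \<kappa> bx[OF un] by (intro mult_mono) auto
          also have "\<dots> = C" by (simp add: exp_minus 4 power2_eq_square field_simps)
          finally show ?thesis by simp
        qed
        moreover have "cmod (H u) \<le> cmod (G u) * exp (- (\<tau>/4 * (Re u * Im u))) * exp (- (\<epsilon> * (\<kappa> * cmod u powr \<beta>)))"
          unfolding normH using e1 by (intro mult_left_mono) auto
        ultimately show "cmod (H u) \<le> C" by linarith
      qed
      then show ?thesis
        unfolding normH norm_mult normE by (simp add: exp_minus field_simps)
    qed
    have "((\<lambda>\<epsilon>. C * exp (\<epsilon> * Re (rot z powr of_real \<beta>))) \<longlongrightarrow> C * exp (0 * Re (rot z powr of_real \<beta>))) (at_right 0)"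
      by (intro tendsto_intros)
    moreover have "\<forall>\<^sub>F \<epsilon> in at_right 0. cmod (G z * exp (\<i> * of_real (\<tau>/8) * z^2)) \<le> C * exp (\<epsilon> * Re (rot z powr of_real \<beta>))"
      using eps by (auto simp: eventually_at_filter)
    ultimately have "cmod (G z * exp (\<i> * of_real (\<tau>/8) * z^2)) \<le> C * exp (0 * Re (rot z powr of_real \<beta>))"
      by (intro tendsto_lowerbound) auto
    then have "cmod (G z) * exp (- (\<tau>/4 * (x0 * y0))) \<le> C"
      by (simp add: norm_mult norm_exp_eq_Re power2_eq_square x0_def y0_def mult.commute)
    then show ?thesis by (simp add: exp_minus field_simps)
  qed
  \<comment> \<open>Below this threshold the fixed point z lies between the two rays, so
    \<open>key\<close> applies.\<close>
  define t0 where "t0 = min (1/2) (min (y0/x0) (x0/y0))"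
  have t0: "t0 > 0" using xy by (simp add: t0_def)
  have "((\<lambda>\<tau>. C * exp (\<tau> / 4 * (x0*y0))) \<longlongrightarrow> C * exp (0 / 4 * (x0*y0))) (at_right 0)"
    by (intro tendsto_intros) auto
  moreover have "\<forall>\<^sub>F \<tau> in at_right 0. cmod (G z) \<le> C * exp (\<tau> / 4 * (x0*y0))"
    unfolding eventually_at_right[OF t0]
  proof (intro exI[of _ t0] conjI allI impI t0)
    fix \<tau> assume "0 < \<tau>" "\<tau> < t0"
    then show "cmod (G z) \<le> C * exp (\<tau> / 4 * (x0*y0))"
      using xy by (intro key) (auto simp: t0_def field_simps)
  qed
  ultimately have "cmod (G z) \<le> C * exp (0 / 4 * (x0*y0))"
    by (intro tendsto_lowerbound) auto
  then show ?thesis by simp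
qed

subsection \<open>The Bessel kernel\<close>

text \<open>Dominated convergence for the partial sums. The cosine and Laguerre series come with a
  pointwise majorant of the partial sums of norms, which is the form of domination used
  here.\<close>

lemma sums_integral_dominated:
  fixes F :: "nat \<Rightarrow> 'a \<Rightarrow> 'b::{banach,second_countable_topology}"
  assumes F: "\<And>i. F i \<in> borel_measurable M" and S: "S \<in> borel_measurable M"
    and W: "integrable M W"
    and sums: "AE x in M. (\<lambda>i. F i x) sums S x"
    and dom: "AE x in M. \<forall>n. (\<Sum>i<n. norm (F i x)) \<le> W x"
  shows "integrable M S" "(\<lambda>i. integral\<^sup>L M (F i)) sums integral\<^sup>L M S"
proof -
  have meas: "(\<lambda>x. \<Sum>i<n. F i x) \<in> borel_measurable M" for n
    using F by simp
  have lim: "AE x in M. (\<lambda>n. \<Sum>i<n. F i x) \<longlonglongrightarrow> S x"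
    using sums by (simp add: sums_def)
  have bd: "AE x in M. norm (\<Sum>i<n. F i x) \<le> W x" for n
    using dom by eventually_elim (blast intro: order_trans[OF norm_sum])
  show "integrable M S"
    by (rule integrable_dominated_convergence[OF S meas W lim bd])
  have "integrable M (F i)" for i
    using dom by (intro Bochner_Integration.integrable_bound[OF W F])
      (auto elim!: eventually_mono intro!: order_trans[OF _ abs_ge_self]
            order_trans[OF member_le_sum[of i "{..<Suc i}" "\<lambda>i. norm (F i _)"]])
  then show "(\<lambda>i. integral\<^sup>L M (F i)) sums integral\<^sup>L M S"
    using integral_dominated_convergence[OF S meas W lim bd]
    by (simp add: sums_def Bochner_Integration.integral_sum)
qed

text \<open>The hypergeometric series 0F1(; \<nu>+1; u) divided by Gamma(\<nu>+1). At u = -z^2/4 it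
  is 2^\<nu> J_\<nu>(z)/z^\<nu>, and at positive u it is the modified Bessel function in the same
  normalization. With u as variable no branch of a power or root enters.\<close>

definition bessel_entire :: "real \<Rightarrow> complex \<Rightarrow> complex" where
  "bessel_entire \<nu> u = (\<Sum>k. u ^ k / of_real (fact k * Gamma (real k + \<nu> + 1)))"

text \<open>In the product formula the first factor \<nu> + 1 exceeds 1/2 and all later factors
  exceed 1.\<close>

lemma Gamma_shift_ge:
  fixes \<nu> :: real
  assumes "\<nu> > -1/2"
  shows "Gamma (\<nu> + 1) / 2 \<le> Gamma (real k + \<nu> + 1)"
proof -
  have pos: "Gamma (\<nu> + 1) > 0" using assms by (intro Gamma_real_pos) auto
  have step: "Gamma (real (Suc k) + \<nu> + 1) = (real k + \<nu> + 1) * Gamma (real k + \<nu> + 1)" for k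
    using Gamma_plus1[of "real k + \<nu> + 1"] nonpos_Ints_nonpos[of "real k + \<nu> + 1"] assms
    by (force simp: add_ac)
  have "Gamma (\<nu> + 1) / 2 \<le> Gamma (real (Suc k) + \<nu> + 1)" for k
  proof (induction k)
    case 0
    then show ?case using step[of 0] pos assms by simp
  next
    case (Suc k)
    have "1 * (Gamma (\<nu> + 1) / 2) \<le> (real (Suc k) + \<nu> + 1) * Gamma (real (Suc k) + \<nu> + 1)"
      using assms pos Suc by (intro mult_mono) auto
    then show ?case using step[of "Suc k"] by simp
  qed
  then show ?thesis using pos by (cases k) auto
qed

lemma Gamma_shift_pos: "(\<nu>::real) > -1/2 \<Longrightarrow> Gamma (real k + \<nu> + 1) > 0"
  by (intro Gamma_real_pos) auto

lemma summable_norm_bessel_entire: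
  assumes "\<nu> > -1/2"
  shows "summable (\<lambda>k. norm (u ^ k / of_real (fact k * Gamma (real k + \<nu> + 1)) :: complex))"
proof (rule summable_comparison_test')
  have "summable (\<lambda>k. cmod u ^ k / fact k)"
    using summable_exp[of "cmod u"] by (simp add: field_simps)
  then show "summable (\<lambda>k. 2 / Gamma (\<nu> + 1) * (cmod u ^ k / fact k))"
    by (rule summable_mult)
  fix k :: nat
  have pos: "Gamma (\<nu> + 1) > 0" using assms by (intro Gamma_real_pos) auto
  have "1 / Gamma (real k + \<nu> + 1) \<le> 1 / (Gamma (\<nu> + 1) / 2)"
    using Gamma_shift_ge[OF assms, of k] pos by (intro divide_left_mono) auto
  then have "1 / Gamma (real k + \<nu> + 1) * (cmod u ^ k / fact k) \<le> 2 / Gamma (\<nu> + 1) * (cmod u ^ k / fact k)"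
    by (intro mult_right_mono) auto
  then show "norm (norm (u ^ k / of_real (fact k * Gamma (real k + \<nu> + 1)) :: complex)) \<le> 2 / Gamma (\<nu> + 1) * (cmod u ^ k / fact k)"
    using Gamma_shift_pos[OF assms, of k]
    by (simp add: norm_divide norm_power norm_mult field_simps)
qed

lemma bessel_entire_sums:
  assumes "\<nu> > -1/2"
  shows "(\<lambda>k. u ^ k / of_real (fact k * Gamma (real k + \<nu> + 1))) sums bessel_entire \<nu> u"
  unfolding bessel_entire_def
  using summable_norm_cancel[OF summable_norm_bessel_entire[OF assms]] by (rule summable_sums)

lemma holomorphic_bessel_entire:
  assumes "\<nu> > -1/2"
  shows "bessel_entire \<nu> holomorphic_on A"
proof -
  have "bessel_entire \<nu> holomorphic_on ball 0 (1 + cmod z)" for z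
    using bessel_entire_sums[OF assms]
    by (intro power_series_holomorphic[where a = "\<lambda>k. 1 / of_real (fact k * Gamma (real k + \<nu> + 1))"]) auto
  then have "bessel_entire \<nu> field_differentiable at z" for z
    by (rule holomorphic_on_imp_differentiable_at[of _ "ball 0 (1 + cmod z)"]) auto
  then show ?thesis by (auto simp: holomorphic_on_def intro: field_differentiable_at_within)
qed

lemma continuous_on_bessel_entire:
  assumes "\<nu> > -1/2"
  shows "continuous_on A (bessel_entire \<nu>)"
  using holomorphic_bessel_entire[OF assms] by (rule holomorphic_on_imp_continuous_on)

lemma bessel_norm_eq_bessel_entire:
  assumes "\<nu> > -1/2"
  shows "complex_of_real (bessel_norm \<nu> z) = of_real (2 powr (-\<nu>)) * bessel_entire \<nu> (- (of_real z ^ 2) / 4)"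
proof -
  have eq: "((- (of_real z ^ 2) / 4) ^ k / of_real (fact k * Gamma (real k + \<nu> + 1)) :: complex)
      = of_real ((-1)^k / (fact k * Gamma (real k + \<nu> + 1)) * (z / 2) ^ (2 * k))" for k
  proof -
    have "(- (of_real z ^ 2) / 4 :: complex) ^ k = (of_real ((-1) * (z/2)^2)) ^ k"
      by (simp add: power2_eq_square)
    also have "\<dots> = of_real ((-1)^k * (z / 2) ^ (2 * k))"
      by (simp only: of_real_power[symmetric] power_mult_distrib power_mult)
    finally show ?thesis by simp
  qed
  have s: "(\<lambda>k. complex_of_real ((-1)^k / (fact k * Gamma (real k + \<nu> + 1)) * (z / 2) ^ (2 * k)))
      sums bessel_entire \<nu> (- (of_real z ^ 2) / 4)"
    using bessel_entire_sums[OF assms, of "- (of_real z ^ 2) / 4"] unfolding eq .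
  have "summable (\<lambda>k. (-1)^k / (fact k * Gamma (real k + \<nu> + 1)) * (z / 2) ^ (2 * k))"
    using sums_Re[OF s] unfolding Re_complex_of_real by (rule sums_summable)
  then have "bessel_entire \<nu> (- (of_real z ^ 2) / 4) = of_real (\<Sum>k. (-1)^k / (fact k * Gamma (real k + \<nu> + 1)) * (z / 2) ^ (2 * k))"
    by (intro sums_unique2[OF s] sums_of_real summable_sums)
  then show ?thesis by (simp add: bessel_norm_def)
qed

subsection \<open>Poisson's integral\<close>

text \<open>Through the Beta moments of Poisson's integral, the factorial of 2k on the right cancels
  the denominator of the cosine series.\<close>

lemma Gamma_half_integer: "Gamma (real k + 1/2) = sqrt pi * fact (2*k) / (4^k * fact k)"
proof (induction k)
  case 0
  show ?case by (simp add: Gamma_one_half_real)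
next
  case (Suc k)
  have "Gamma (real (Suc k) + 1/2) = (real k + 1/2) * Gamma (real k + 1/2)"
    using Gamma_plus1[of "real k + 1/2"] nonpos_Ints_nonpos[of "real k + 1/2"] by (force simp: add_ac)
  also have "\<dots> = (real k + 1/2) * (sqrt pi * fact (2*k) / (4^k * fact k))" by (simp only: Suc)
  also have "\<dots> = sqrt pi * ((2 * real k + 2) * (2 * real k + 1) * fact (2*k)) / (4 * 4^k * ((real k + 1) * fact k))"
    by (simp add: divide_simps) (simp add: algebra_simps)
  also have "(2 * real k + 2) * (2 * real k + 1) * fact (2*k) = fact (2 * Suc k)"
    by (simp add: algebra_simps)
  also have "4 * 4^k * ((real k + 1) * fact k) = 4^Suc k * fact (Suc k)" by simp
  finally show ?case .
qed

text \<open>Poisson's integral has the weight (1 - s^2)^(\<nu> - 1/2) against cos(z s) on (0,1).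
  Here u = s^2 is substituted, up to a factor 2, so that the moments in u are Beta values.\<close>

definition poisson_weight :: "real \<Rightarrow> real \<Rightarrow> real" where
  "poisson_weight \<nu> u = indicator {0<..<1} u * (u powr (-1/2) * (1 - u) powr (\<nu> - 1/2))"

lemma poisson_weight_nonneg: "poisson_weight \<nu> u \<ge> 0"
  by (auto simp: poisson_weight_def)

lemma measurable_poisson_weight [measurable]: "poisson_weight \<nu> \<in> borel_measurable borel"
  unfolding poisson_weight_def by measurable

lemma has_bochner_integral_poisson_weight:
  assumes "\<nu> > -1/2"
  shows "has_bochner_integral lborel (\<lambda>u. poisson_weight \<nu> u * u ^ k) (Beta (real k + 1/2) (\<nu> + 1/2))"
proof (rule has_bochner_integral_nn_integral)
  have "((\<lambda>t. t powr (real k + 1/2 - 1) * (1 - t) powr (\<nu> + 1/2 - 1)) has_integral Beta (real k + 1/2) (\<nu> + 1/2)) {0..1}"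
    using assms by (intro has_integral_Beta_real) auto
  then have "((\<lambda>t. t powr (real k + 1/2 - 1) * (1 - t) powr (\<nu> + 1/2 - 1)) has_integral Beta (real k + 1/2) (\<nu> + 1/2)) {0<..<1}"
    by (simp add: has_integral_Icc_iff_Ioo)
  then have "((\<lambda>t. poisson_weight \<nu> t * t^k) has_integral Beta (real k + 1/2) (\<nu> + 1/2)) {0<..<1}"
  proof (rule has_integral_eq[rotated])
    fix t :: real assume "t \<in> {0<..<1}"
    moreover from this have "t powr (real k + 1/2 - 1) = t powr (-1/2) * t^k"
      by (simp flip: powr_add powr_realpow)
    ultimately show "t powr (real k + 1/2 - 1) * (1 - t) powr (\<nu> + 1/2 - 1) = poisson_weight \<nu> t * t^k"
      by (simp add: poisson_weight_def)
  qed
  then have I: "((\<lambda>t. poisson_weight \<nu> t * t^k) has_integral Beta (real k + 1/2) (\<nu> + 1/2)) UNIV"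
    by (rule has_integral_on_superset) (auto simp: poisson_weight_def)
  have nn: "0 \<le> poisson_weight \<nu> t * t^k" for t
    by (auto simp: poisson_weight_def indicator_def)
  show "0 \<le> Beta (real k + 1/2) (\<nu> + 1/2)" using has_integral_nonneg[OF I] nn by simp
  show "(\<integral>\<^sup>+ x. ennreal (poisson_weight \<nu> x * x^k) \<partial>lborel) = ennreal (Beta (real k + 1/2) (\<nu> + 1/2))"
    by (rule nn_integral_has_integral_lborel[OF _ nn I]) measurable
  show "AE x in lborel. 0 \<le> poisson_weight \<nu> x * x^k" using nn by simp
  show "(\<lambda>u. poisson_weight \<nu> u * u ^ k) \<in> borel_measurable lborel" by measurable
qed

lemma integrable_poisson_weight: "\<nu> > -1/2 \<Longrightarrow> integrable lborel (poisson_weight \<nu>)"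
  using has_bochner_integral_poisson_weight[of \<nu> 0]
  unfolding has_bochner_integral_iff power_0 mult_1_right by blast

lemma cos_even_sums:
  fixes z :: complex
  shows "(\<lambda>k. (-1)^k * z^(2*k) / fact (2*k)) sums cos z"
proof -
  have "(\<lambda>n. cos_coeff (2*n) *\<^sub>R z^(2*n)) sums cos z"
    using cos_converges[of z]
    by (subst sums_mono_reindex[where f = "\<lambda>n. cos_coeff n *\<^sub>R z^n"])
       (auto simp: strict_mono_def cos_coeff_def elim!: evenE)
  then show ?thesis by (simp add: cos_coeff_def scaleR_conv_of_real)
qed

lemma cmod_cos_le: "cmod (cos z) \<le> exp \<bar>Im z\<bar>"
proof -
  have "cmod (cos z) \<le> (cmod (exp (\<i> * z)) + cmod (exp (- (\<i> * z)))) / 2"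
    using norm_triangle_ineq[of "exp (\<i> * z)" "exp (- (\<i> * z))"] by (simp add: cos_exp_eq norm_divide)
  also have "\<dots> \<le> (exp \<bar>Im z\<bar> + exp \<bar>Im z\<bar>) / 2"
    by (intro divide_right_mono add_mono) auto
  finally show ?thesis by simp
qed

text \<open>Integrating the cosine series term by term gives Beta values which reduce to the
  coefficients of \<open>bessel_entire\<close>. The point of the formula is that cosine grows only
  with |Im z|, which termwise absolute values in the power series would not show.\<close>

lemma bessel_entire_poisson_integral:
  assumes nu: "\<nu> > -1/2"
  shows "bessel_entire \<nu> (- (z^2) / 4) =
    of_real (1 / (sqrt pi * Gamma (\<nu> + 1/2))) * (\<integral>u. of_real (poisson_weight \<nu> u) * cos (z * of_real (sqrt u)) \<partial>lborel)"
proof -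
  define F where "F = (\<lambda>k u. complex_of_real (poisson_weight \<nu> u * u^k) * ((-1)^k * z^(2*k) / fact (2*k)))"
  have sum_le: "(\<Sum>k<n. cmod z ^ (2*k) / fact (2*k)) \<le> exp (cmod z)" for n
  proof -
    have "(\<Sum>k<n. cmod z ^ (2*k) / fact (2*k)) = (\<Sum>m\<in>(*) 2 ` {..<n}. cmod z ^ m / fact m)"
      by (subst sum.reindex) (auto simp: inj_on_def)
    also have "\<dots> \<le> (\<Sum>m. cmod z ^ m / fact m)"
      using summable_exp[of "cmod z"] by (intro sum_le_suminf) (auto simp: field_simps)
    also have "\<dots> = exp (cmod z)" by (simp add: exp_def field_simps)
    finally show ?thesis .
  qed
  have "(\<lambda>k. integral\<^sup>L lborel (F k)) sums (\<integral>u. of_real (poisson_weight \<nu> u) * cos (z * of_real (sqrt u)) \<partial>lborel)"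
  proof (rule sums_integral_dominated)
    show "F i \<in> borel_measurable lborel" for i unfolding F_def by measurable
    show "(\<lambda>u. of_real (poisson_weight \<nu> u) * cos (z * of_real (sqrt u))) \<in> borel_measurable lborel"
      unfolding cos_exp_eq by measurable
    show "integrable lborel (\<lambda>u. poisson_weight \<nu> u * exp (cmod z))"
      using integrable_poisson_weight[OF nu] by simp
    have "(\<lambda>i. F i u) sums (of_real (poisson_weight \<nu> u) * cos (z * of_real (sqrt u)))" for u
    proof (cases "u \<ge> 0")
      case True
      have "complex_of_real (poisson_weight \<nu> u) * ((-1)^i * (z * of_real (sqrt u))^(2*i) / fact (2*i)) = F i u" for i
        using True by (simp add: F_def power_mult_distrib power_mult flip: of_real_power)
      then show ?thesis
        using sums_mult[OF cos_even_sums[of "z * of_real (sqrt u)"], of "of_real (poisson_weight \<nu> u)"] by simp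
    qed (simp add: F_def poisson_weight_def)
    then show "AE u in lborel. (\<lambda>i. F i u) sums (of_real (poisson_weight \<nu> u) * cos (z * of_real (sqrt u)))"
      by simp
    have "(\<Sum>i<n. norm (F i u)) \<le> poisson_weight \<nu> u * exp (cmod z)" for n u
    proof (cases "u \<in> {0<..<1}")
      case True
      have "(\<Sum>i<n. norm (F i u)) \<le> (\<Sum>i<n. poisson_weight \<nu> u * (cmod z ^ (2*i) / fact (2*i)))"
      proof (rule sum_mono)
        fix i
        have "u^i * (cmod z ^ (2*i) / fact (2*i)) \<le> 1 * (cmod z ^ (2*i) / fact (2*i))"
          using True by (intro mult_right_mono power_le_one) auto
        then have "poisson_weight \<nu> u * (u^i * (cmod z ^ (2*i) / fact (2*i))) \<le> poisson_weight \<nu> u * (cmod z ^ (2*i) / fact (2*i))"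
          using poisson_weight_nonneg[of \<nu> u] by (intro mult_left_mono) auto
        then show "norm (F i u) \<le> poisson_weight \<nu> u * (cmod z ^ (2*i) / fact (2*i))"
          using poisson_weight_nonneg[of \<nu> u] True
          by (simp add: F_def norm_mult norm_divide norm_power mult.assoc)
      qed
      also have "\<dots> \<le> poisson_weight \<nu> u * exp (cmod z)"
        unfolding sum_distrib_left[symmetric]
        by (intro mult_left_mono sum_le poisson_weight_nonneg)
      finally show ?thesis .
    qed (simp add: F_def poisson_weight_def)
    then show "AE u in lborel. \<forall>n. (\<Sum>i<n. norm (F i u)) \<le> poisson_weight \<nu> u * exp (cmod z)" by simp
  qed
  moreover have "integral\<^sup>L lborel (F k) = of_real (sqrt pi * Gamma (\<nu> + 1/2)) * ((- (z^2) / 4) ^ k / of_real (fact k * Gamma (real k + \<nu> + 1)))" for k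
  proof -
    have B: "Beta (real k + 1/2) (\<nu> + 1/2) = sqrt pi * Gamma (\<nu> + 1/2) * (fact (2*k) / (4^k * fact k * Gamma (real k + \<nu> + 1)))"
      by (simp add: Beta_def Gamma_half_integer add_ac)
    have "integral\<^sup>L lborel (F k) = of_real (Beta (real k + 1/2) (\<nu> + 1/2)) * ((-1)^k * z^(2*k) / fact (2*k))"
      using has_bochner_integral_poisson_weight[OF nu, of k] unfolding F_def has_bochner_integral_iff
      by (simp only: integral_mult_left_zero integral_complex_of_real)
    also have "\<dots> = of_real (sqrt pi * Gamma (\<nu> + 1/2)) * ((- (z^2) / 4) ^ k / of_real (fact k * Gamma (real k + \<nu> + 1)))"
    proof -
      have "(- (z^2) / 4)^k = (-1)^k * z^(2*k) / 4^k"
        using power_mult_distrib[of "-1" "z^2/4" k] by (simp add: power_divide power_mult)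
      then show ?thesis unfolding B by simp
    qed
    finally show ?thesis .
  qed
  ultimately have "(\<lambda>k. of_real (sqrt pi * Gamma (\<nu> + 1/2)) * ((- (z^2) / 4) ^ k / of_real (fact k * Gamma (real k + \<nu> + 1)))) sums
      (\<integral>u. of_real (poisson_weight \<nu> u) * cos (z * of_real (sqrt u)) \<partial>lborel)"
    by simp
  moreover have "(\<lambda>k. of_real (sqrt pi * Gamma (\<nu> + 1/2)) * ((- (z^2) / 4) ^ k / of_real (fact k * Gamma (real k + \<nu> + 1)))) sums
      (of_real (sqrt pi * Gamma (\<nu> + 1/2)) * bessel_entire \<nu> (- (z^2) / 4))"
    by (intro sums_mult bessel_entire_sums nu)
  ultimately have eq: "(\<integral>u. of_real (poisson_weight \<nu> u) * cos (z * of_real (sqrt u)) \<partial>lborel) =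
      of_real (sqrt pi * Gamma (\<nu> + 1/2)) * bessel_entire \<nu> (- (z^2) / 4)"
    using sums_unique2 by blast
  have "Gamma (\<nu> + 1/2) > 0" using nu by (intro Gamma_real_pos) auto
  then show ?thesis unfolding eq by simp
qed

text \<open>One change of variables in Euler's integral covers c s, s^2/2 and c s^2. Nonnegativity
  of the integrand carries the result from the gauge integral to the Lebesgue integral.\<close>

lemma Gamma_integral_substitution:
  fixes g g' :: "real \<Rightarrow> real"
  assumes x: "x > 0"
    and g: "\<And>s. s > 0 \<Longrightarrow> (g has_field_derivative g' s) (at s)" "\<And>s. s > 0 \<Longrightarrow> g' s > 0"
    and inj: "inj_on g {0<..}" and im: "g ` {0<..} = {0<..}"
    and meas: "(\<lambda>s. g' s * (g s powr (x - 1) * exp (- g s))) \<in> borel_measurable borel"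
  shows "has_bochner_integral lborel (\<lambda>s. indicator {0<..} s * (g' s * (g s powr (x - 1) * exp (- g s)))) (Gamma x)"
proof -
  define f where "f = (\<lambda>t::real. t powr (x - 1) * exp (- t))"
  define h where "h = (\<lambda>s. indicator {0<..} s * (g' s * f (g s)))"
  have "(f has_integral Gamma x) {0..}"
    using Gamma_integral_real[OF x] by (simp add: f_def exp_minus field_simps)
  then have "((\<lambda>t. if t \<in> {0<..} then f t else 0) has_integral Gamma x) {0..}"
    by (rule has_integral_spike [of "{0}", rotated 2]) auto
  then have f: "(f has_integral Gamma x) {0<..}"
    by (subst (asm) has_integral_restrict) auto
  then have "f absolutely_integrable_on g ` {0<..} \<and> integral (g ` {0<..}) f = Gamma x"
    unfolding im by (auto simp: absolutely_integrable_on_iff_nonneg f_def has_integral_iff)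
  then have "(\<lambda>s. \<bar>g' s\<bar> * f (g s)) absolutely_integrable_on {0<..} \<and>
      integral {0<..} (\<lambda>s. \<bar>g' s\<bar> * f (g s)) = Gamma x"
    using g inj by (subst has_absolute_integral_change_of_variables_1') (auto intro: has_field_derivative_at_within)
  then have "((\<lambda>s. \<bar>g' s\<bar> * f (g s)) has_integral Gamma x) {0<..}"
    using set_lebesgue_integral_eq_integral(1) by (auto simp: has_integral_iff)
  then have "(h has_integral Gamma x) {0<..}"
    by (rule has_integral_eq[rotated]) (auto simp: h_def abs_of_pos[OF g(2)])
  then have I: "(h has_integral Gamma x) UNIV"
    by (rule has_integral_on_superset) (auto simp: h_def)
  have nn: "0 \<le> h s" for s
    using g(2)[of s] by (auto simp: h_def f_def indicator_def)
  have hm: "h \<in> borel_measurable borel"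
    unfolding h_def f_def by (intro borel_measurable_times[OF _ meas]) auto
  have "has_bochner_integral lborel h (Gamma x)"
  proof (rule has_bochner_integral_nn_integral)
    show "0 \<le> Gamma x" using Gamma_real_pos[OF x] by simp
    show "(\<integral>\<^sup>+ s. ennreal (h s) \<partial>lborel) = ennreal (Gamma x)"
      by (rule nn_integral_has_integral_lborel[OF hm nn I])
  qed (use hm nn in auto)
  then show ?thesis by (simp add: h_def f_def)
qed

lemma has_bochner_integral_Gamma_scaled:
  fixes c x :: real
  assumes "x > 0" "c > 0"
  shows "has_bochner_integral lborel (\<lambda>s. indicator {0<..} s * (s powr (x - 1) * exp (- (c * s)))) (Gamma x / c powr x)"
proof -
  have im: "(\<lambda>s. c * s) ` {0<..} = {0<..}"
  proof (intro equalityI subsetI)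
    fix t :: real assume "t \<in> {0<..}"
    then show "t \<in> (\<lambda>s. c * s) ` {0<..}" using assms by (intro image_eqI[of _ _ "t/c"]) auto
  qed (use assms in auto)
  have "has_bochner_integral lborel (\<lambda>s. indicator {0<..} s * (c * ((c * s) powr (x - 1) * exp (- (c * s))))) (Gamma x)"
    by (rule Gamma_integral_substitution[where g = "\<lambda>s. c * s" and g' = "\<lambda>_. c"])
      (use assms im in \<open>auto intro!: derivative_eq_intros inj_onI\<close>)
  then have "has_bochner_integral lborel (\<lambda>s. (indicator {0<..} s * (c * ((c * s) powr (x - 1) * exp (- (c * s))))) / c powr x) (Gamma x / c powr x)"
    using assms by (intro has_bochner_integral_divide) auto
  moreover have "(indicator {0<..} s * (c * ((c * s) powr (x - 1) * exp (- (c * s))))) / c powr x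
      = indicator {0<..} s * (s powr (x - 1) * exp (- (c * s)))" for s
    using assms by (auto simp: indicator_def powr_mult powr_diff)
  ultimately show ?thesis by simp
qed

text \<open>Raise y \<le> exp y, at y = c x / m, to the power m.\<close>

lemma powr_le_const_exp:
  fixes x m c :: real
  assumes "x > 0" "m > 0" "c > 0"
  shows "x powr m \<le> (m / c) powr m * exp (c * x)"
proof -
  have eq: "x powr m = (m / c) powr m * (c * x / m) powr m"
    using assms by (simp flip: powr_mult)
  have "c * x / m \<le> exp (c * x / m)"
    using exp_ge_add_one_self[of "c * x / m"] by linarith
  then have "(c * x / m) powr m \<le> exp (c * x / m) powr m"
    using assms by (intro powr_mono2) auto
  also have "exp (c * x / m) powr m = exp (c * x)" using assms by (simp add: exp_powr_real)
  finally have "(c * x / m) powr m \<le> exp (c * x)" .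
  then have "(m / c) powr m * (c * x / m) powr m \<le> (m / c) powr m * exp (c * x)"
    by (intro mult_left_mono) auto
  then show ?thesis unfolding eq .
qed

text \<open>The mean inequality sqrt u \<le> (1 + u)/2 splits off the full growth exp |Im z| and
  leaves exponential decay in the distance 1 - u from the endpoint. That decay is what later yields
  a negative power of |Im z|.\<close>

lemma cmod_poisson_integrand_le:
  assumes "u \<in> {0<..<1}"
  shows "cmod (cos (z * of_real (sqrt u))) \<le> exp \<bar>Im z\<bar> * exp (- (\<bar>Im z\<bar> / 2 * (1 - u)))"
proof -
  have "sqrt u \<le> (1 + u) / 2"
    using assms arith_geo_mean_sqrt[of 1 u] by simp
  then have "\<bar>Im z\<bar> * sqrt u \<le> \<bar>Im z\<bar> * ((1 + u) / 2)" by (intro mult_left_mono) auto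
  also have "\<dots> = \<bar>Im z\<bar> - \<bar>Im z\<bar> / 2 * (1 - u)" by (simp add: field_simps)
  finally have "exp \<bar>Im (z * of_real (sqrt u))\<bar> \<le> exp (\<bar>Im z\<bar> - \<bar>Im z\<bar> / 2 * (1 - u))"
    using assms by (simp add: abs_mult)
  also have "\<dots> = exp \<bar>Im z\<bar> * exp (- (\<bar>Im z\<bar> / 2 * (1 - u)))" by (simp flip: exp_add)
  finally show ?thesis using cmod_cos_le[of "z * of_real (sqrt u)"] by (rule order_trans[rotated])
qed

text \<open>Near u = 1 Poisson's integrand is dominated by a Gamma integrand in 1 - u, and its
  integral is a multiple of |Im z|^(-\<nu>-1/2), the order known from the asymptotics of Bessel
  functions. The first bound is kept because the second degenerates as Im z tends to 0.\<close>

lemma bessel_entire_exp_bound: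
  assumes nu: "\<nu> > -1/2"
  obtains K where "K > 0" "\<And>z. cmod (bessel_entire \<nu> (- (z^2) / 4)) \<le> K * exp \<bar>Im z\<bar>"
    "\<And>z. Im z \<noteq> 0 \<Longrightarrow> cmod (bessel_entire \<nu> (- (z^2) / 4)) \<le> K * exp \<bar>Im z\<bar> * \<bar>Im z\<bar> powr (- \<nu> - 1/2)"
proof -
  define \<mu> where "\<mu> = \<nu> + 1/2"
  have \<mu>: "\<mu> > 0" using nu by (simp add: \<mu>_def)
  define c where "c = 1 / (sqrt pi * Gamma \<mu>)"
  have c: "c > 0" using Gamma_real_pos[OF \<mu>] by (simp add: c_def)
  define B where "B = integral\<^sup>L lborel (poisson_weight \<nu>)"
  have B: "B \<ge> 0" unfolding B_def by (intro integral_nonneg_AE AE_I2 poisson_weight_nonneg)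
  define G where "G = (\<lambda>y v. indicator {0<..} v * (v powr (\<mu> - 1) * exp (- (y/2 * v))) :: real)"
  have G: "has_bochner_integral lborel (G y) (Gamma \<mu> / (y/2) powr \<mu>)" if "y > 0" for y
    unfolding G_def using that \<mu> by (intro has_bochner_integral_Gamma_scaled) auto
  have G': "has_bochner_integral lborel (\<lambda>u. G y (1 - u)) (Gamma \<mu> / (y/2) powr \<mu>)" if "y > 0" for y
    using lborel_has_bochner_integral_real_affine_iff[of "-1" "G y" "Gamma \<mu> / (y/2) powr \<mu>" 1] G[OF that] by simp
  have rep: "cmod (bessel_entire \<nu> (- (z^2) / 4)) \<le> c * integral\<^sup>L lborel W"
    if W: "integrable lborel W" "\<And>u. u \<in> {0<..<1} \<Longrightarrow> poisson_weight \<nu> u * cmod (cos (z * of_real (sqrt u))) \<le> W u"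
      "\<And>u. 0 \<le> W u" for W z
  proof -
    have "cmod (\<integral>u. of_real (poisson_weight \<nu> u) * cos (z * of_real (sqrt u)) \<partial>lborel) \<le> integral\<^sup>L lborel W"
    proof (rule Bochner_Integration.integral_norm_bound_integral)
      have le: "cmod (of_real (poisson_weight \<nu> u) * cos (z * of_real (sqrt u))) \<le> W u" for u
      proof (cases "u \<in> {0<..<1}")
        case True
        then show ?thesis using W(2)[of u] poisson_weight_nonneg[of \<nu> u] by (simp add: norm_mult)
      next
        case False
        then show ?thesis using W(3)[of u] by (simp add: poisson_weight_def)
      qed
      then show "cmod (of_real (poisson_weight \<nu> u) * cos (z * of_real (sqrt u))) \<le> W u" for u .
      have "(\<lambda>u. of_real (poisson_weight \<nu> u) * cos (z * of_real (sqrt u))) \<in> borel_measurable lborel"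
        unfolding cos_exp_eq by measurable
      then show "integrable lborel (\<lambda>u. of_real (poisson_weight \<nu> u) * cos (z * of_real (sqrt u)))"
        using le by (intro Bochner_Integration.integrable_bound[OF W(1)]) (auto intro: order_trans[OF _ abs_ge_self])
    qed (use W in auto)
    then show ?thesis
      unfolding bessel_entire_poisson_integral[OF nu] norm_mult using c
      by (simp add: c_def \<mu>_def divide_right_mono del: of_real_divide of_real_mult)
  qed
  \<comment> \<open>One constant for both bounds. The quotient by 1/4 is the constant of
    \<open>powr_le_const_exp\<close> at rate 1/4, by which exp(-y/4) is turned into a multiple of
    y^(-\<mu>).\<close>
  define K where "K = 1 + c * B + c * (B * (\<mu> / (1/4)) powr \<mu> + sqrt 2 * (Gamma \<mu> * 2 powr \<mu>))"
  have nn: "0 \<le> c * B" "0 \<le> c * (B * (\<mu> / (1/4)) powr \<mu> + sqrt 2 * (Gamma \<mu> * 2 powr \<mu>))"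
    using c B Gamma_real_pos[OF \<mu>] by auto
  show thesis
  proof (rule that[of K])
    show "K > 0" using nn by (simp add: K_def)
    fix z :: complex
    define y where "y = \<bar>Im z\<bar>"
    have "cmod (bessel_entire \<nu> (- (z^2) / 4)) \<le> c * integral\<^sup>L lborel (\<lambda>u. poisson_weight \<nu> u * exp y)"
    proof (rule rep)
      show "integrable lborel (\<lambda>u. poisson_weight \<nu> u * exp y)" using integrable_poisson_weight[OF nu] by simp
      show "poisson_weight \<nu> u * cmod (cos (z * of_real (sqrt u))) \<le> poisson_weight \<nu> u * exp y" if "u \<in> {0<..<1}" for u
      proof (rule mult_left_mono[OF _ poisson_weight_nonneg])
        have "exp y * exp (- (y / 2 * (1 - u))) \<le> exp y * 1"
          using that by (intro mult_left_mono) (auto simp: y_def)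
        then show "cmod (cos (z * of_real (sqrt u))) \<le> exp y"
          using cmod_poisson_integrand_le[OF that, of z] unfolding y_def by linarith
      qed
      show "0 \<le> poisson_weight \<nu> u * exp y" for u using poisson_weight_nonneg[of \<nu> u] by simp
    qed
    also have "\<dots> = c * B * exp y" by (simp add: B_def)
    also have "\<dots> \<le> K * exp y" using nn by (intro mult_right_mono) (auto simp: K_def)
    finally show "cmod (bessel_entire \<nu> (- (z^2) / 4)) \<le> K * exp \<bar>Im z\<bar>" by (simp add: y_def)
    assume "Im z \<noteq> 0"
    then have y: "y > 0" by (simp add: y_def)
    \<comment> \<open>The first summand majorizes u \<le> 1/2, where 1 - u \<ge> 1/2 gains
      exp(-y/4). The second majorizes u > 1/2, where u^(-1/2) \<le> sqrt 2 and the rest is the Gamma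
      integrand at 1 - u.\<close>
    define W where "W = (\<lambda>u. exp y * (exp (- (y/4)) * poisson_weight \<nu> u + sqrt 2 * G y (1 - u)))"
    have Gn: "G y v \<ge> 0" for v by (simp add: G_def)
    have "cmod (bessel_entire \<nu> (- (z^2) / 4)) \<le> c * integral\<^sup>L lborel W"
    proof (rule rep)
      show "integrable lborel W" unfolding W_def
        using integrable_poisson_weight[OF nu] G'[OF y] by (simp add: has_bochner_integral_iff)
      show "0 \<le> W u" for u using Gn[of "1-u"] poisson_weight_nonneg[of \<nu> u] by (simp add: W_def)
      fix u :: real assume u: "u \<in> {0<..<1}"
      have "poisson_weight \<nu> u * exp (- (y / 2 * (1 - u))) \<le> exp (- (y/4)) * poisson_weight \<nu> u + sqrt 2 * G y (1 - u)"
      proof (cases "u \<le> 1/2")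
        case True
        have "y * u \<le> y * (1/2)" using True y by (intro mult_left_mono) auto
        then have "exp (- (y / 2 * (1 - u))) \<le> exp (- (y/4))" by (simp add: field_simps)
        then have "poisson_weight \<nu> u * exp (- (y / 2 * (1 - u))) \<le> poisson_weight \<nu> u * exp (- (y/4))"
          using poisson_weight_nonneg by (intro mult_left_mono)
        moreover have "0 \<le> sqrt 2 * G y (1 - u)" using Gn[of "1-u"] by simp
        ultimately show ?thesis by (simp add: mult.commute)
      next
        case False
        have "sqrt (1/2) \<le> sqrt u" using False by (intro real_sqrt_le_mono) auto
        then have "1 / sqrt u \<le> 1 / sqrt (1/2)" using u by (intro divide_left_mono) auto
        then have "u powr (-1/2) \<le> sqrt 2" using u by (simp add: powr_minus powr_half_sqrt real_sqrt_divide field_simps flip: minus_divide_left)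
        then have "u powr (-1/2) * ((1-u) powr (\<mu> - 1) * exp (- (y / 2 * (1 - u)))) \<le> sqrt 2 * ((1-u) powr (\<mu> - 1) * exp (- (y / 2 * (1 - u))))"
          by (intro mult_right_mono) auto
        moreover have "0 \<le> exp (- (y/4)) * poisson_weight \<nu> u" using poisson_weight_nonneg[of \<nu> u] by simp
        moreover have e1: "poisson_weight \<nu> u * exp (- (y / 2 * (1 - u))) = u powr (-1/2) * ((1-u) powr (\<mu> - 1) * exp (- (y / 2 * (1 - u))))"
          using u by (simp add: poisson_weight_def \<mu>_def mult.assoc)
        moreover have e2: "G y (1 - u) = (1-u) powr (\<mu> - 1) * exp (- (y / 2 * (1 - u)))"
          using u by (simp add: G_def)
        ultimately show ?thesis unfolding e1 e2 by linarith
      qed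
      then have "exp y * (poisson_weight \<nu> u * exp (- (y / 2 * (1 - u)))) \<le> W u"
        unfolding W_def by (intro mult_left_mono) auto
      moreover have "poisson_weight \<nu> u * cmod (cos (z * of_real (sqrt u))) \<le> poisson_weight \<nu> u * (exp y * exp (- (y / 2 * (1 - u))))"
        unfolding y_def by (intro mult_left_mono cmod_poisson_integrand_le u poisson_weight_nonneg)
      ultimately show "poisson_weight \<nu> u * cmod (cos (z * of_real (sqrt u))) \<le> W u"
        by (simp add: mult_ac)
    qed
    also have "integral\<^sup>L lborel W = exp y * (exp (- (y/4)) * B + sqrt 2 * (Gamma \<mu> / (y/2) powr \<mu>))"
      unfolding W_def B_def using integrable_poisson_weight[OF nu] G'[OF y] by (simp add: has_bochner_integral_iff)
    also have "\<dots> \<le> exp y * (((\<mu> / (1/4)) powr \<mu> * B + sqrt 2 * (Gamma \<mu> * 2 powr \<mu>)) * y powr (- \<mu>))"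
    proof (rule mult_left_mono)
      have "exp (- (y/4)) \<le> (\<mu> / (1/4)) powr \<mu> * y powr (- \<mu>)"
        using powr_le_const_exp[OF y \<mu>, of "1/4"] y by (simp add: powr_minus exp_minus field_simps)
      then have "exp (- (y/4)) * B \<le> ((\<mu> / (1/4)) powr \<mu> * y powr (- \<mu>)) * B" using B by (intro mult_right_mono) auto
      moreover have "Gamma \<mu> / (y/2) powr \<mu> = Gamma \<mu> * 2 powr \<mu> * y powr (- \<mu>)"
        using y by (simp add: powr_divide powr_minus field_simps)
      ultimately show "exp (- (y/4)) * B + sqrt 2 * (Gamma \<mu> / (y/2) powr \<mu>) \<le> ((\<mu> / (1/4)) powr \<mu> * B + sqrt 2 * (Gamma \<mu> * 2 powr \<mu>)) * y powr (- \<mu>)"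
        by (simp add: algebra_simps)
    qed auto
    also have "c * (exp y * (((\<mu> / (1/4)) powr \<mu> * B + sqrt 2 * (Gamma \<mu> * 2 powr \<mu>)) * y powr (- \<mu>)))
        = c * (B * (\<mu> / (1/4)) powr \<mu> + sqrt 2 * (Gamma \<mu> * 2 powr \<mu>)) * exp y * y powr (- \<mu>)"
      by (simp add: algebra_simps)
    also have "\<dots> \<le> K * exp y * y powr (- \<mu>)"
      using nn by (intro mult_right_mono) (auto simp: K_def)
    finally show "cmod (bessel_entire \<nu> (- (z^2) / 4)) \<le> K * exp \<bar>Im z\<bar> * \<bar>Im z\<bar> powr (- \<nu> - 1/2)"
      using c by (simp add: y_def \<mu>_def)
  qed
qed

subsection \<open>Laguerre polynomials\<close>

text \<open>The Cauchy product of exp t with the Bessel series at -x t. In contrast to the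
  generating function with unweighted Laguerre polynomials, division by Gamma(k + \<nu> + 1) makes
  the sum entire in t.\<close>

lemma laguerre_generating_function:
  assumes nu: "\<nu> > -1/2"
  shows "(\<lambda>k. of_real (laguerre k \<nu> x / Gamma (real k + \<nu> + 1)) * t ^ k) sums
    (exp t * bessel_entire \<nu> (- (of_real x * t)))"
proof -
  define a where "a = (\<lambda>i. (- (complex_of_real x * t))^i / of_real (fact i * Gamma (real i + \<nu> + 1)))"
  define b where "b = (\<lambda>m. t^m / fact m)"
  have sa: "summable (\<lambda>k. norm (a k))" unfolding a_def by (rule summable_norm_bessel_entire[OF nu])
  have sb: "summable (\<lambda>k. norm (b k))"
    using summable_norm_exp[of t] by (simp add: b_def divide_inverse mult.commute scaleR_conv_of_real)
  have "(\<lambda>k. \<Sum>i\<le>k. a i * b (k - i)) sums (suminf a * suminf b)"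
    by (rule Cauchy_product_sums[OF sa sb])
  moreover have "suminf a = bessel_entire \<nu> (- (of_real x * t))"
    by (simp add: a_def bessel_entire_def)
  moreover have "suminf b = exp t"
    by (simp add: b_def exp_def divide_inverse mult.commute scaleR_conv_of_real)
  moreover have "(\<Sum>i\<le>k. a i * b (k - i)) = of_real (laguerre k \<nu> x / Gamma (real k + \<nu> + 1)) * t ^ k" for k
  proof -
    have "a i * b (k - i) = of_real ((-1)^i * Gamma (real k + \<nu> + 1) / (Gamma (real i + \<nu> + 1) * fact (k - i) * fact i) * x ^ i / Gamma (real k + \<nu> + 1)) * t ^ k"
      if "i \<le> k" for i
    proof -
      have "(- (of_real x * t)) ^ i = (-1)^i * of_real x ^ i * t^i"
        using power_mult_distrib[of "-1" "of_real x * t" i] by (simp add: power_mult_distrib)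
      moreover have "t ^ i * t ^ (k - i) = t ^ k" using that by (simp flip: power_add)
      ultimately show ?thesis using Gamma_shift_pos[OF nu, of k]
        by (simp add: a_def b_def mult.assoc)
    qed
    then have "(\<Sum>i\<le>k. a i * b (k - i)) = (\<Sum>i\<le>k. of_real ((-1)^i * Gamma (real k + \<nu> + 1) / (Gamma (real i + \<nu> + 1) * fact (k - i) * fact i) * x ^ i / Gamma (real k + \<nu> + 1)) * t ^ k)"
      by (intro sum.cong) auto
    also have "\<dots> = of_real (laguerre k \<nu> x / Gamma (real k + \<nu> + 1)) * t ^ k"
      by (simp only: laguerre_def sum_divide_distrib of_real_sum sum_distrib_right)
    finally show ?thesis .
  qed
  ultimately show ?thesis by (simp add: mult.commute)
qed

text \<open>The coefficients alternate in sign, so at -|x| every term equals its absolute value. The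
  majorant is again a Laguerre value and can be summed by the generating function.\<close>

lemma abs_laguerre_le:
  assumes nu: "\<nu> > -1/2"
  shows "\<bar>laguerre k \<nu> x\<bar> \<le> laguerre k \<nu> (- \<bar>x\<bar>)"
proof -
  have "\<bar>laguerre k \<nu> x\<bar> \<le> (\<Sum>j\<le>k. \<bar>(-1)^j * Gamma (real k + \<nu> + 1) / (Gamma (real j + \<nu> + 1) * fact (k - j) * fact j) * x ^ j\<bar>)"
    unfolding laguerre_def by (rule sum_abs)
  also have "\<dots> = laguerre k \<nu> (- \<bar>x\<bar>)"
    unfolding laguerre_def
  proof (rule sum.cong[OF refl])
    fix j
    have "(-1)^j * (- \<bar>x\<bar>)^j = \<bar>x\<bar>^j" by (simp flip: power_mult_distrib)
    then show "\<bar>(-1)^j * Gamma (real k + \<nu> + 1) / (Gamma (real j + \<nu> + 1) * fact (k - j) * fact j) * x ^ j\<bar>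
        = (-1)^j * Gamma (real k + \<nu> + 1) / (Gamma (real j + \<nu> + 1) * fact (k - j) * fact j) * (- \<bar>x\<bar>) ^ j"
      using Gamma_shift_pos[OF nu, of k] Gamma_shift_pos[OF nu, of j]
      by (simp add: abs_mult power_abs mult_ac)
  qed
  finally show ?thesis .
qed

text \<open>At -|x| all terms are nonnegative, so partial sums stay below the closed form. This is
  the majorant, uniform in n, for the exchange of sum and integral in the transform.\<close>

lemma laguerre_generating_function_bound:
  assumes nu: "\<nu> > -1/2" and "\<tau> \<ge> 0"
  shows "(\<Sum>k<n. \<bar>laguerre k \<nu> x\<bar> / Gamma (real k + \<nu> + 1) * \<tau> ^ k) \<le>
    exp \<tau> * cmod (bessel_entire \<nu> (of_real (\<bar>x\<bar> * \<tau>)))"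
proof -
  define c where "c = (\<lambda>k. laguerre k \<nu> (- \<bar>x\<bar>) / Gamma (real k + \<nu> + 1) * \<tau> ^ k)"
  have "(\<lambda>k. of_real (c k)) sums (exp (of_real \<tau>) * bessel_entire \<nu> (of_real (\<bar>x\<bar> * \<tau>)))"
    using laguerre_generating_function[OF nu, of "- \<bar>x\<bar>" "of_real \<tau>"] by (simp add: c_def)
  from sums_Re[OF this] have c: "c sums Re (exp (of_real \<tau>) * bessel_entire \<nu> (of_real (\<bar>x\<bar> * \<tau>)))"
    by simp
  have le: "\<bar>laguerre k \<nu> x\<bar> / Gamma (real k + \<nu> + 1) * \<tau> ^ k \<le> c k" for k
    unfolding c_def using assms(2) Gamma_shift_pos[OF nu, of k]
    by (intro mult_right_mono divide_right_mono abs_laguerre_le[OF nu]) auto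
  have nn: "0 \<le> c k" for k
    using le[of k] assms(2) Gamma_shift_pos[OF nu, of k] by (intro order_trans[OF _ le]) auto
  have "(\<Sum>k<n. \<bar>laguerre k \<nu> x\<bar> / Gamma (real k + \<nu> + 1) * \<tau> ^ k) \<le> (\<Sum>k<n. c k)"
    by (intro sum_mono le)
  also have "\<dots> \<le> suminf c" using c nn by (intro sum_le_suminf) (auto simp: sums_iff)
  also have "\<dots> = Re (exp (of_real \<tau>) * bessel_entire \<nu> (of_real (\<bar>x\<bar> * \<tau>)))" using c by (simp add: sums_iff)
  also have "\<dots> \<le> cmod (exp (of_real \<tau>) * bessel_entire \<nu> (of_real (\<bar>x\<bar> * \<tau>)))" by (rule complex_Re_le_cmod)
  also have "\<dots> = exp \<tau> * cmod (bessel_entire \<nu> (of_real (\<bar>x\<bar> * \<tau>)))" by (simp add: norm_mult)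
  finally show ?thesis .
qed

text \<open>Kummer's transformation of the confluent hypergeometric series; on coefficients it is
  the Chu--Vandermonde identity.\<close>
lemma laguerre_kummer_sums:
  fixes Y :: real
  assumes nu: "\<nu> > -1/2"
  shows "(\<lambda>m. Y ^ m / fact m * (Gamma (real (m + j) + \<nu> + 1) / Gamma (real m + \<nu> + 1))) sums
    (fact j * exp Y * laguerre j \<nu> (- Y))"
proof -
  \<comment> \<open>The binomial coefficient cuts this sequence off after j, so the left factor of
    the Cauchy product is a polynomial in Y.\<close>
  define a where "a = (\<lambda>i. real (j choose i) * (Gamma (real j + \<nu> + 1) / Gamma (real i + \<nu> + 1)) * Y^i)"
  define b where "b = (\<lambda>m. Y^m / fact m)"
  have a0: "a i = 0" if "i \<notin> {..j}" for i using that by (simp add: a_def)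
  have sa: "summable (\<lambda>k. norm (a k))" by (rule summable_finite[of "{..j}"]) (auto simp: a0)
  have sb: "summable (\<lambda>k. norm (b k))"
    using summable_norm_exp[of Y] by (simp add: b_def divide_inverse mult.commute)
  have "(\<lambda>k. \<Sum>i\<le>k. a i * b (k - i)) sums (suminf a * suminf b)"
    by (rule Cauchy_product_sums[OF sa sb])
  moreover have "suminf a = fact j * laguerre j \<nu> (- Y)"
  proof -
    have "suminf a = sum a {..j}" by (rule suminf_finite) (auto simp: a0)
    also have "\<dots> = (\<Sum>i\<le>j. fact j * ((-1)^i * Gamma (real j + \<nu> + 1) / (Gamma (real i + \<nu> + 1) * fact (j - i) * fact i) * (- Y) ^ i))"
    proof (rule sum.cong[OF refl])
      fix i assume "i \<in> {..j}"
      then have "real (j choose i) = fact j / (fact i * fact (j - i))" by (simp add: binomial_fact)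
      moreover have "(-1)^i * (- Y)^i = Y^i" by (simp flip: power_mult_distrib)
      ultimately show "a i = fact j * ((-1)^i * Gamma (real j + \<nu> + 1) / (Gamma (real i + \<nu> + 1) * fact (j - i) * fact i) * (- Y) ^ i)"
        by (simp add: a_def mult_ac)
    qed
    also have "\<dots> = fact j * laguerre j \<nu> (- Y)" by (simp only: laguerre_def sum_distrib_left)
    finally show ?thesis .
  qed
  moreover have "suminf b = exp Y"
    by (simp add: b_def exp_def divide_inverse mult.commute)
  moreover have "(\<Sum>i\<le>m. a i * b (m - i)) = Y ^ m / fact m * (Gamma (real (m + j) + \<nu> + 1) / Gamma (real m + \<nu> + 1))" for m
  proof -
    define A where "A = Gamma (real j + \<nu> + 1)"
    define B where "B = Gamma (real m + \<nu> + 1)"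
    have AB: "A > 0" "B > 0" unfolding A_def B_def by (intro Gamma_shift_pos nu)+
    have nonpole: "real m + \<nu> + 1 \<notin> \<int>\<^sub>\<le>\<^sub>0" "real j + (real m + \<nu>) + 1 \<notin> \<int>\<^sub>\<le>\<^sub>0"
      using nu nonpos_Ints_nonpos[of "real m + \<nu> + 1"] nonpos_Ints_nonpos[of "real j + (real m + \<nu>) + 1"] by force+
    have "a i * b (m - i) = Y^m * (A / B) * ((real j gchoose i) * ((real m + \<nu>) gchoose (m - i)))" if "i \<le> m" for i
    proof -
      have "(real m + \<nu>) gchoose (m - i) = B / (fact (m - i) * Gamma (real i + \<nu> + 1))"
        using that by (subst gbinomial_Gamma[OF nonpole(1)]) (simp add: B_def of_nat_diff add_ac)
      moreover have "Y ^ i * Y ^ (m - i) = Y ^ m" using that by (simp flip: power_add)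
      ultimately show ?thesis using AB
        by (simp add: a_def b_def binomial_gbinomial A_def[symmetric] mult.assoc) (simp add: mult_ac)
    qed
    then have "(\<Sum>i\<le>m. a i * b (m - i)) = (\<Sum>i\<in>{0..m}. Y^m * (A / B) * ((real j gchoose i) * ((real m + \<nu>) gchoose (m - i))))"
      by (intro sum.cong) auto
    also have "\<dots> = Y^m * (A / B) * ((real j + (real m + \<nu>)) gchoose m)"
      by (simp only: sum_distrib_left[symmetric] gbinomial_Vandermonde)
    also have "(real j + (real m + \<nu>)) gchoose m = Gamma (real (m + j) + \<nu> + 1) / (fact m * A)"
      by (subst gbinomial_Gamma[OF nonpole(2)]) (simp add: A_def add_ac)
    finally show ?thesis using AB by (simp add: B_def)
  qed
  ultimately show ?thesis by (simp add: mult_ac)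
qed

subsection \<open>Integrals against the Hankel measure\<close>

text \<open>Encoded as a measure on the whole line, with density 0 for r \<le> 0, so that Fubini and
  the convergence theorems apply directly, without set integrals.\<close>

definition hankel_measure :: "real \<Rightarrow> real measure" where
  "hankel_measure \<nu> = density lborel (\<lambda>r. ennreal (indicator {0<..} r * r powr (2 * \<nu> + 1)))"

lemma sets_hankel_measure [measurable_cong, simp]: "sets (hankel_measure \<nu>) = sets borel"
  by (simp add: hankel_measure_def)

lemma space_hankel_measure [simp]: "space (hankel_measure \<nu>) = UNIV"
  by (simp add: hankel_measure_def)

lemma sigma_finite_hankel_measure: "sigma_finite_measure (hankel_measure \<nu>)"
  unfolding hankel_measure_def
  by (subst sigma_finite_measure.sigma_finite_iff_density_finite[OF sigma_finite_lborel]) auto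

lemma AE_hankel_measure_pos: "AE r in hankel_measure \<nu>. r > 0"
  unfolding hankel_measure_def by (subst AE_density) (auto simp: indicator_def)

lemma integral_hankel_measure:
  fixes g :: "real \<Rightarrow> 'a::{banach,second_countable_topology}"
  assumes "g \<in> borel_measurable borel"
  shows "integral\<^sup>L (hankel_measure \<nu>) g = (LINT r:{0<..}|lborel. (r powr (2 * \<nu> + 1)) *\<^sub>R g r)"
  unfolding hankel_measure_def using assms
  by (subst integral_density) (auto simp: set_lebesgue_integral_def)

lemma integrable_hankel_measure_iff:
  fixes g :: "real \<Rightarrow> 'a::{banach,second_countable_topology}"
  assumes "g \<in> borel_measurable borel"
  shows "integrable (hankel_measure \<nu>) g \<longleftrightarrow> set_integrable lborel {0<..} (\<lambda>r. (r powr (2 * \<nu> + 1)) *\<^sub>R g r)"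
  unfolding hankel_measure_def using assms
  by (subst integrable_density) (auto simp: set_integrable_def)

lemma has_bochner_integral_hankel_gaussian_moment:
  assumes nu: "\<nu> > -1/2"
  shows "has_bochner_integral (hankel_measure \<nu>) (\<lambda>s. s ^ (2 * j) * exp (- (s^2) / 2))
    (2 powr (real j + \<nu>) * Gamma (real j + \<nu> + 1))"
proof -
  have im: "(\<lambda>s::real. s^2/2) ` {0<..} = {0<..}"
  proof (intro equalityI subsetI)
    fix t :: real assume "t \<in> {0<..}"
    then show "t \<in> (\<lambda>s. s^2/2) ` {0<..}" by (intro image_eqI[of _ _ "sqrt (2*t)"]) auto
  qed auto
  have "has_bochner_integral lborel (\<lambda>s. indicator {0<..} s * (s * ((s^2/2) powr (real j + \<nu> + 1 - 1) * exp (- (s^2/2))))) (Gamma (real j + \<nu> + 1))"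
  proof (rule Gamma_integral_substitution[where g = "\<lambda>s. s^2/2" and g' = "\<lambda>s. s"])
    show "inj_on (\<lambda>s::real. s^2/2) {0<..}" by (auto intro!: inj_onI simp: power2_eq_iff_nonneg)
  qed (use nu im in \<open>auto intro!: derivative_eq_intros\<close>)
  then have scaled: "has_bochner_integral lborel (\<lambda>s. 2 powr (real j + \<nu>) * (indicator {0<..} s * (s * ((s^2/2) powr (real j + \<nu> + 1 - 1) * exp (- (s^2/2))))))
      (2 powr (real j + \<nu>) * Gamma (real j + \<nu> + 1))"
    by (intro has_bochner_integral_mult_right) auto
  have eq: "2 powr (real j + \<nu>) * (indicator {0<..} s * (s * ((s^2/2) powr (real j + \<nu> + 1 - 1) * exp (- (s^2/2)))))
      = (indicator {0<..} s * s powr (2 * \<nu> + 1)) *\<^sub>R (s ^ (2 * j) * exp (- (s^2) / 2))" for s :: real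
  proof (cases "s > 0")
    case True
    have "2 powr (real j + \<nu>) * (s * (s^2/2) powr (real j + \<nu>)) = s * (s^2) powr (real j + \<nu>)"
      using True by (simp add: powr_divide)
    also have "(s^2) powr (real j + \<nu>) = s powr (2 * (real j + \<nu>))"
      using True by (simp add: powr_powr flip: powr_numeral)
    also have "s * s powr (2 * (real j + \<nu>)) = s powr (2 * \<nu> + 1) * s powr (2 * real j)"
      using True by (simp add: powr_mult_base flip: powr_add) (simp add: algebra_simps)
    also have "s powr (2 * real j) = s ^ (2 * j)"
      using True powr_realpow[of s "2*j"] by simp
    finally show ?thesis using True by (simp add: mult.assoc[symmetric])
  qed simp
  show ?thesis unfolding hankel_measure_def
    by (rule has_bochner_integral_density[OF _ _ _ scaled[unfolded eq]]) auto
qed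

lemma bessel_norm_sums:
  assumes nu: "\<nu> > -1/2"
  shows "summable (\<lambda>k. norm ((-1)^k / (fact k * Gamma (real k + \<nu> + 1)) * (z / 2) ^ (2 * k)))"
    and "(\<lambda>k. 2 powr (-\<nu>) * ((-1)^k / (fact k * Gamma (real k + \<nu> + 1)) * (z / 2) ^ (2 * k))) sums bessel_norm \<nu> z"
proof -
  have "norm ((of_real ((z/2)^2) :: complex) ^ k / of_real (fact k * Gamma (real k + \<nu> + 1)))
     = norm ((-1)^k / (fact k * Gamma (real k + \<nu> + 1)) * (z / 2) ^ (2 * k))" for k
    using Gamma_shift_pos[OF nu, of k] by (simp add: norm_divide norm_mult norm_power power_mult abs_mult power_divide)
  then show *: "summable (\<lambda>k. norm ((-1)^k / (fact k * Gamma (real k + \<nu> + 1)) * (z / 2) ^ (2 * k)))"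
    using summable_norm_bessel_entire[OF nu, of "of_real ((z/2)^2)"] by simp
  show "(\<lambda>k. 2 powr (-\<nu>) * ((-1)^k / (fact k * Gamma (real k + \<nu> + 1)) * (z / 2) ^ (2 * k))) sums bessel_norm \<nu> z"
    unfolding bessel_norm_def by (intro sums_mult summable_sums summable_norm_cancel[OF *])
qed

lemma continuous_on_bessel_norm [continuous_intros]:
  assumes nu: "\<nu> > -1/2" and "continuous_on A g"
  shows "continuous_on A (\<lambda>x. bessel_norm \<nu> (g x))"
proof -
  have eq: "bessel_norm \<nu> z = Re (of_real (2 powr (-\<nu>)) * bessel_entire \<nu> (- (of_real z ^ 2) / 4))" for z
    using bessel_norm_eq_bessel_entire[OF nu, of z] by (metis Re_complex_of_real)
  show ?thesis unfolding eq
    by (intro continuous_intros assms continuous_on_compose2[OF continuous_on_bessel_entire[OF nu, of UNIV]]) auto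
qed

text \<open>Integrating the Bessel series term by term against Gaussian moments gives Kummer's
  series at Y = -r^2/2, which sums to a Gaussian times a Laguerre polynomial.\<close>

lemma hankel_transform_gaussian_monomial:
  assumes nu: "\<nu> > -1/2"
  shows "integral\<^sup>L (hankel_measure \<nu>) (\<lambda>s. bessel_norm \<nu> (r * s) * (s ^ (2 * j) * exp (- (s^2) / 2)))
    = 2 ^ j * fact j * exp (- (r^2) / 2) * laguerre j \<nu> (r^2 / 2)"
proof -
  define M where "M = (\<lambda>m s::real. s ^ (2 * m) * exp (- (s^2) / 2))"
  have M: "integrable (hankel_measure \<nu>) (M m)" "integral\<^sup>L (hankel_measure \<nu>) (M m) = 2 powr (real m + \<nu>) * Gamma (real m + \<nu> + 1)" for m
    using has_bochner_integral_hankel_gaussian_moment[OF nu, of m] by (auto simp: has_bochner_integral_iff M_def)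
  define c where "c = (\<lambda>m. 2 powr (-\<nu>) * ((-1)^m / (fact m * Gamma (real m + \<nu> + 1)) * (r / 2) ^ (2 * m)))"
  define F where "F = (\<lambda>m s. c m * M (m + j) s)"
  have Feq: "F m s = 2 powr (-\<nu>) * ((-1)^m / (fact m * Gamma (real m + \<nu> + 1)) * (r * s / 2) ^ (2 * m)) * M j s" for m s
    by (simp add: F_def c_def M_def power_mult_distrib power_add distrib_left power_divide)
  have int_c: "c m * (2 powr (real (m + j) + \<nu>) * Gamma (real (m + j) + \<nu> + 1)) =
     2^j * ((- (r^2) / 2) ^ m / fact m * (Gamma (real (m + j) + \<nu> + 1) / Gamma (real m + \<nu> + 1)))" for m
  proof -
    have "(- (r^2) / 2) ^ m = (-1)^m * (r/2)^(2*m) * 2^m"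
      using power_mult_distrib[of "-1 * (r/2)^2" 2 m] power_mult_distrib[of "-1" "(r/2)^2" m]
      by (simp add: power_mult power2_eq_square)
    moreover have "2 powr (-\<nu>) * 2 powr (real (m + j) + \<nu>) = 2^m * 2^j"
      by (simp flip: powr_add) (simp add: powr_add powr_realpow)
    ultimately show ?thesis by (simp add: c_def mult_ac)
  qed
  have Mn: "norm (M m s) = M m s" for m s by (simp add: M_def power_mult)
  have S: "(\<lambda>m. integral\<^sup>L (hankel_measure \<nu>) (F m)) sums integral\<^sup>L (hankel_measure \<nu>) (\<lambda>s. \<Sum>m. F m s)"
  proof (rule sums_integral)
    show "integrable (hankel_measure \<nu>) (F m)" for m unfolding F_def using M by simp
    show "AE s in hankel_measure \<nu>. summable (\<lambda>m. norm (F m s))"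
    proof (rule AE_I2)
      fix s
      have "norm (F m s) = norm (2 powr (-\<nu>) * M j s) * norm ((-1)^m / (fact m * Gamma (real m + \<nu> + 1)) * (r * s / 2) ^ (2 * m))" for m
        unfolding Feq by (simp add: abs_mult)
      then show "summable (\<lambda>m. norm (F m s))"
        using summable_mult[OF bessel_norm_sums(1)[OF nu, of "r * s"]] by presburger
    qed
    have n1: "integral\<^sup>L (hankel_measure \<nu>) (\<lambda>s. norm (F m s)) = \<bar>c m\<bar> * (2 powr (real (m + j) + \<nu>) * Gamma (real (m + j) + \<nu> + 1))" for m
      unfolding F_def norm_mult Mn using M[of "m + j"] by simp
    \<comment> \<open>Taking absolute values only changes the sign of Y, so Kummer's series also
      proves the absolute convergence.\<close>
    have n2: "\<bar>c m\<bar> * (2 powr (real (m + j) + \<nu>) * Gamma (real (m + j) + \<nu> + 1)) = 2^j * ((r^2 / 2) ^ m / fact m * (Gamma (real (m + j) + \<nu> + 1) / Gamma (real m + \<nu> + 1)))" for m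
      using arg_cong[OF int_c[of m], of abs] Gamma_shift_pos[OF nu, of m] Gamma_shift_pos[OF nu, of "m+j"]
      by (simp add: abs_mult power_abs)
    show "summable (\<lambda>m. integral\<^sup>L (hankel_measure \<nu>) (\<lambda>s. norm (F m s)))"
      unfolding n1 n2 using summable_mult[OF sums_summable[OF laguerre_kummer_sums[OF nu, of "r^2/2" j]], of "2^j"] by simp
  qed
  have I: "integral\<^sup>L (hankel_measure \<nu>) (F m) = 2^j * ((- (r^2) / 2) ^ m / fact m * (Gamma (real (m + j) + \<nu> + 1) / Gamma (real m + \<nu> + 1)))" for m
    using M[of "m+j"] int_c[of m] by (simp add: F_def)
  have F: "(\<Sum>m. F m s) = bessel_norm \<nu> (r * s) * M j s" for s
    unfolding Feq using sums_mult2[OF bessel_norm_sums(2)[OF nu, of "r * s"], of "M j s"] by (simp add: sums_iff)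
  have "(\<lambda>m. 2^j * ((- (r^2) / 2) ^ m / fact m * (Gamma (real (m + j) + \<nu> + 1) / Gamma (real m + \<nu> + 1)))) sums
      integral\<^sup>L (hankel_measure \<nu>) (\<lambda>s. bessel_norm \<nu> (r * s) * M j s)"
    using S unfolding I F .
  moreover have "(\<lambda>m. 2^j * ((- (r^2) / 2) ^ m / fact m * (Gamma (real (m + j) + \<nu> + 1) / Gamma (real m + \<nu> + 1)))) sums
      (2^j * (fact j * exp (- (r^2) / 2) * laguerre j \<nu> (r^2 / 2)))"
    using sums_mult[OF laguerre_kummer_sums[OF nu, of "- (r^2)/2" j], of "2^j"] by simp
  ultimately show ?thesis unfolding M_def by (simp add: sums_unique2 mult.assoc)
qed

lemma integrable_hankel_gaussian:
  assumes nu: "\<nu> > -1/2" and c: "c > 0"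
  shows "integrable (hankel_measure \<nu>) (\<lambda>s. exp (- (c * s^2)))"
proof -
  have im: "(\<lambda>s::real. c * s^2) ` {0<..} = {0<..}"
  proof (intro equalityI subsetI)
    fix t :: real assume "t \<in> {0<..}"
    then show "t \<in> (\<lambda>s. c * s^2) ` {0<..}" using c by (intro image_eqI[of _ _ "sqrt (t / c)"]) auto
  qed (use c in auto)
  have "has_bochner_integral lborel (\<lambda>s. indicator {0<..} s * (2 * c * s * ((c * s^2) powr (\<nu> + 1 - 1) * exp (- (c * s^2))))) (Gamma (\<nu> + 1))"
  proof (rule Gamma_integral_substitution[where g = "\<lambda>s. c * s^2" and g' = "\<lambda>s. 2 * c * s"])
    show "inj_on (\<lambda>s::real. c * s^2) {0<..}" using c by (auto intro!: inj_onI simp: power2_eq_iff_nonneg)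
  qed (use nu im c in \<open>auto intro!: derivative_eq_intros\<close>)
  then have int: "integrable lborel (\<lambda>s. 1 / (2 * c powr (\<nu> + 1)) * (indicator {0<..} s * (2 * c * s * ((c * s^2) powr (\<nu> + 1 - 1) * exp (- (c * s^2))))))"
    by (intro integrable_mult_right) (auto simp: has_bochner_integral_iff)
  have eq: "1 / (2 * c powr (\<nu> + 1)) * (indicator {0<..} s * (2 * c * s * ((c * s^2) powr (\<nu> + 1 - 1) * exp (- (c * s^2)))))
      = (indicator {0<..} s * s powr (2 * \<nu> + 1)) *\<^sub>R exp (- (c * s^2))" for s :: real
  proof (cases "s > 0")
    case True
    have "c * s * (c * s^2) powr \<nu> = c powr (\<nu> + 1) * (s * (s^2) powr \<nu>)"
      using c True by (simp add: powr_mult powr_add)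
    also have "(s^2) powr \<nu> = s powr (2 * \<nu>)"
      using True by (simp add: powr_powr flip: powr_numeral)
    also have "s * s powr (2 * \<nu>) = s powr (2 * \<nu> + 1)"
      using True by (simp add: powr_mult_base add.commute)
    finally show ?thesis using True c by (simp add: field_simps)
  qed simp
  show ?thesis unfolding hankel_measure_def
    by (subst integrable_density) (use int[unfolded eq] in auto)
qed

text \<open>The Gaussian moment contains the same Gamma value as the denominator of the series
  coefficient. After cancellation the terms are bounded by a multiple of (2|t|)^j / j!, for any
  bounded h. The constant h = 1 gives integrability of the Gaussian kernel, and h a Bessel function
  gives its Hankel transform.\<close>

lemma bessel_entire_square_integral:
  assumes nu: "\<nu> > -1/2" and h: "h \<in> borel_measurable borel" and H: "\<And>s. \<bar>h s\<bar> \<le> H"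
  shows "integrable (hankel_measure \<nu>) (\<lambda>s. of_real (h s * exp (- (s^2) / 2)) * bessel_entire \<nu> (of_real (s^2) * t))"
    and "(\<lambda>j. of_real (integral\<^sup>L (hankel_measure \<nu>) (\<lambda>s. h s * (s ^ (2 * j) * exp (- (s^2) / 2)))) * (t ^ j / of_real (fact j * Gamma (real j + \<nu> + 1))))
      sums integral\<^sup>L (hankel_measure \<nu>) (\<lambda>s. of_real (h s * exp (- (s^2) / 2)) * bessel_entire \<nu> (of_real (s^2) * t))"
proof -
  define M where "M = (\<lambda>m s::real. s ^ (2 * m) * exp (- (s^2) / 2))"
  have M: "integrable (hankel_measure \<nu>) (M m)" "integral\<^sup>L (hankel_measure \<nu>) (M m) = 2 powr (real m + \<nu>) * Gamma (real m + \<nu> + 1)" for m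
    using has_bochner_integral_hankel_gaussian_moment[OF nu, of m] by (auto simp: has_bochner_integral_iff M_def)
  have Mn: "norm (M m s) = M m s" "0 \<le> M m s" for m s by (simp_all add: M_def power_mult)
  have hM: "norm (h s * M m s) \<le> norm (H * M m s)" for m s
  proof -
    have "\<bar>h s\<bar> * M m s \<le> \<bar>H\<bar> * M m s" using H[of s] Mn(2)[of m s] by (intro mult_right_mono) auto
    then show ?thesis by (simp add: norm_mult abs_mult Mn(1)[unfolded real_norm_def])
  qed
  have inthM: "integrable (hankel_measure \<nu>) (\<lambda>s. h s * M m s)" for m
  proof (rule Bochner_Integration.integrable_bound)
    show "integrable (hankel_measure \<nu>) (\<lambda>s. H * M m s)" using M by simp
    show "(\<lambda>s. h s * M m s) \<in> borel_measurable (hankel_measure \<nu>)"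
      using h unfolding M_def by measurable
    show "AE s in hankel_measure \<nu>. norm (h s * M m s) \<le> norm (H * M m s)" using hM by blast
  qed
  define d where "d = (\<lambda>j. t ^ j / of_real (fact j * Gamma (real j + \<nu> + 1)))"
  define F where "F = (\<lambda>j s. complex_of_real (h s * M j s) * d j)"
  have Fs: "F j s = of_real (h s * exp (- (s^2) / 2)) * ((of_real (s^2) * t) ^ j / of_real (fact j * Gamma (real j + \<nu> + 1)))" for j s
    by (simp add: F_def d_def M_def power_mult_distrib power_mult)
  have i1: "integrable (hankel_measure \<nu>) (F j)" for j
    unfolding F_def using inthM[of j] by (intro integrable_mult_left integrable_of_real)
  have i2: "AE s in hankel_measure \<nu>. summable (\<lambda>j. norm (F j s))"
    unfolding Fs norm_mult by (intro AE_I2 summable_mult summable_norm_bessel_entire nu)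
  have i3: "summable (\<lambda>j. integral\<^sup>L (hankel_measure \<nu>) (\<lambda>s. norm (F j s)))"
  proof (rule summable_comparison_test')
    have "summable (\<lambda>j. (2 * cmod t) ^ j / fact j)"
      using summable_exp[of "2 * cmod t"] by (simp add: field_simps)
    then show "summable (\<lambda>j. \<bar>H\<bar> * 2 powr \<nu> * ((2 * cmod t) ^ j / fact j))" by (rule summable_mult)
    fix j :: nat
    have "integral\<^sup>L (hankel_measure \<nu>) (\<lambda>s. norm (F j s)) \<le> integral\<^sup>L (hankel_measure \<nu>) (\<lambda>s. \<bar>H\<bar> * M j s * cmod (d j))"
    proof (rule integral_mono)
      show "integrable (hankel_measure \<nu>) (\<lambda>s. norm (F j s))" using i1 by (rule integrable_norm)
      show "integrable (hankel_measure \<nu>) (\<lambda>s. \<bar>H\<bar> * M j s * cmod (d j))" using M by simp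
      show "norm (F j s) \<le> \<bar>H\<bar> * M j s * cmod (d j)" for s
        unfolding F_def norm_mult[of "of_real _"] norm_of_real using hM[where s = s and m = j]
        by (intro mult_right_mono) (auto simp: abs_mult Mn(1)[unfolded real_norm_def])
    qed
    also have "\<dots> = \<bar>H\<bar> * (2 powr (real j + \<nu>) * Gamma (real j + \<nu> + 1)) * cmod (d j)"
      by (simp add: M)
    also have "\<dots> = \<bar>H\<bar> * 2 powr \<nu> * ((2 * cmod t) ^ j / fact j)"
      using Gamma_shift_pos[OF nu, of j]
      by (simp add: d_def norm_divide norm_mult norm_power powr_add powr_realpow power_mult_distrib)
    finally show "norm (integral\<^sup>L (hankel_measure \<nu>) (\<lambda>s. norm (F j s))) \<le> \<bar>H\<bar> * 2 powr \<nu> * ((2 * cmod t) ^ j / fact j)"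
      by simp
  qed
  have Fsum: "(\<Sum>j. F j s) = of_real (h s * exp (- (s^2) / 2)) * bessel_entire \<nu> (of_real (s^2) * t)" for s
    unfolding Fs using sums_mult[OF bessel_entire_sums[OF nu, of "of_real (s^2) * t"], of "of_real (h s * exp (- (s^2) / 2))"]
    by (rule sums_unique[symmetric])
  show "integrable (hankel_measure \<nu>) (\<lambda>s. of_real (h s * exp (- (s^2) / 2)) * bessel_entire \<nu> (of_real (s^2) * t))"
    using integrable_suminf[OF i1 i2 i3] unfolding Fsum .
  have Fint: "integral\<^sup>L (hankel_measure \<nu>) (F j) = of_real (integral\<^sup>L (hankel_measure \<nu>) (\<lambda>s. h s * M j s)) * d j" for j
    unfolding F_def by (simp only: integral_mult_left_zero integral_complex_of_real)
  show "(\<lambda>j. of_real (integral\<^sup>L (hankel_measure \<nu>) (\<lambda>s. h s * (s ^ (2 * j) * exp (- (s^2) / 2)))) * (t ^ j / of_real (fact j * Gamma (real j + \<nu> + 1))))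
      sums integral\<^sup>L (hankel_measure \<nu>) (\<lambda>s. of_real (h s * exp (- (s^2) / 2)) * bessel_entire \<nu> (of_real (s^2) * t))"
    using sums_integral[OF i1 i2 i3] unfolding Fsum Fint M_def d_def .
qed

lemma abs_bessel_norm_bounded:
  assumes nu: "\<nu> > -1/2"
  obtains K where "\<And>z. \<bar>bessel_norm \<nu> z\<bar> \<le> K"
proof -
  obtain K where K: "K > 0" "\<And>z. cmod (bessel_entire \<nu> (- (z^2) / 4)) \<le> K * exp \<bar>Im z\<bar>"
    using bessel_entire_exp_bound[OF nu] by metis
  have "\<bar>bessel_norm \<nu> z\<bar> \<le> 2 powr (-\<nu>) * K" for z
  proof -
    have "\<bar>bessel_norm \<nu> z\<bar> = cmod (of_real (bessel_norm \<nu> z))" by simp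
    also have "\<dots> = 2 powr (-\<nu>) * cmod (bessel_entire \<nu> (- (of_real z ^ 2) / 4))"
      unfolding bessel_norm_eq_bessel_entire[OF nu] by (simp add: norm_mult)
    also have "\<dots> \<le> 2 powr (-\<nu>) * K" using K(2)[of "of_real z"] by (intro mult_left_mono) auto
    finally show ?thesis .
  qed
  then show thesis by (rule that)
qed

lemma measurable_bessel_norm:
  assumes "\<nu> > -1/2"
  shows "bessel_norm \<nu> \<in> borel_measurable borel"
  using continuous_on_bessel_norm[OF assms continuous_on_id] by (rule borel_measurable_continuous_onI)

text \<open>Weber's second exponential integral.\<close>
lemma hankel_transform_gaussian_bessel:
  assumes nu: "\<nu> > -1/2"
  shows "integral\<^sup>L (hankel_measure \<nu>) (\<lambda>s. of_real (bessel_norm \<nu> (r * s) * exp (- (s^2) / 2)) * bessel_entire \<nu> (of_real (s^2) * t))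
    = exp (2 * t) * of_real (exp (- (r^2) / 2)) * bessel_entire \<nu> (- (of_real (r^2) * t))"
proof -
  obtain K where K: "\<And>z. \<bar>bessel_norm \<nu> z\<bar> \<le> K" by (rule abs_bessel_norm_bounded[OF nu]) blast
  have "(\<lambda>j. of_real (integral\<^sup>L (hankel_measure \<nu>) (\<lambda>s. bessel_norm \<nu> (r * s) * (s ^ (2 * j) * exp (- (s^2) / 2)))) * (t ^ j / of_real (fact j * Gamma (real j + \<nu> + 1))))
      sums integral\<^sup>L (hankel_measure \<nu>) (\<lambda>s. of_real (bessel_norm \<nu> (r * s) * exp (- (s^2) / 2)) * bessel_entire \<nu> (of_real (s^2) * t))"
    using measurable_bessel_norm[OF nu] K by (intro bessel_entire_square_integral(2)[OF nu]) auto
  \<comment> \<open>The factor \<open>2 ^ j * fact j\<close> of the transformed monomial cancels the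
    factorial and turns t^j into (2t)^j. The Laguerre generating function at r^2/2 and 2t then
    resums the series: its Bessel argument is again -r^2 t, and the factor exp(2t) appears.\<close>
  moreover have "of_real (integral\<^sup>L (hankel_measure \<nu>) (\<lambda>s. bessel_norm \<nu> (r * s) * (s ^ (2 * j) * exp (- (s^2) / 2)))) * (t ^ j / of_real (fact j * Gamma (real j + \<nu> + 1)))
     = of_real (exp (- (r^2) / 2)) * (of_real (laguerre j \<nu> (r^2/2) / Gamma (real j + \<nu> + 1)) * (2 * t) ^ j)" for j
    unfolding hankel_transform_gaussian_monomial[OF nu] by (simp add: power_mult_distrib)
  moreover have "(\<lambda>j. of_real (exp (- (r^2) / 2)) * (of_real (laguerre j \<nu> (r^2/2) / Gamma (real j + \<nu> + 1)) * (2 * t) ^ j)) sums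
     (of_real (exp (- (r^2) / 2)) * (exp (2 * t) * bessel_entire \<nu> (- (of_real (r^2/2) * (2 * t)))))"
    by (intro sums_mult laguerre_generating_function nu)
  ultimately have "integral\<^sup>L (hankel_measure \<nu>) (\<lambda>s. of_real (bessel_norm \<nu> (r * s) * exp (- (s^2) / 2)) * bessel_entire \<nu> (of_real (s^2) * t))
     = of_real (exp (- (r^2) / 2)) * (exp (2 * t) * bessel_entire \<nu> (- (of_real (r^2/2) * (2 * t))))"
    by (simp only: sums_iff)
  then show ?thesis by (simp add: mult_ac)
qed

subsection \<open>The Laguerre transform\<close>

text \<open>If g is not integrable, its Bochner integral is 0 by convention and the majorant is
  nonnegative almost everywhere. Pointwise bounds thus suffice when transforms are
  estimated.\<close>

lemma norm_integral_le_majorant: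
  fixes g :: "'a \<Rightarrow> 'b::{banach,second_countable_topology}"
  assumes W: "integrable M W" and le: "AE x in M. norm (g x) \<le> W x"
  shows "norm (integral\<^sup>L M g) \<le> integral\<^sup>L M W"
proof (cases "integrable M g")
  case True
  have "norm (integral\<^sup>L M g) \<le> integral\<^sup>L M (\<lambda>x. norm (g x))" by (rule integral_norm_bound)
  also have "\<dots> \<le> integral\<^sup>L M W" by (intro integral_mono_AE integrable_norm True W le)
  finally show ?thesis .
next
  case False
  have "AE x in M. 0 \<le> W x" using le by eventually_elim (meson norm_ge_zero order_trans)
  then show ?thesis using False by (simp add: not_integrable_integral_eq integral_nonneg_AE)
qed

text \<open>The Bessel factor is at most K exp(2|r| sqrt \<tau>), and completing the square, (|r| -
  2 sqrt \<tau>)^2 \<ge> 0, trades this for exp(r^2/2 + 2\<tau>). The bound is uniform in r, so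
  integrability of F is all that the transform requires.\<close>

lemma gaussian_bessel_entire_bound:
  assumes nu: "\<nu> > -1/2"
  obtains K where "K > 0"
    "\<And>r u \<tau>. 0 \<le> \<tau> \<Longrightarrow> cmod u = r^2 * \<tau> \<Longrightarrow> exp (- (r^2) / 2) * cmod (bessel_entire \<nu> u) \<le> K * exp (2 * \<tau>)"
proof -
  obtain K where K: "K > 0" "\<And>z. cmod (bessel_entire \<nu> (- (z^2) / 4)) \<le> K * exp \<bar>Im z\<bar>"
    using bessel_entire_exp_bound[OF nu] by metis
  show thesis
  proof (rule that[OF K(1)])
    fix r \<tau> :: real and u :: complex assume \<tau>: "0 \<le> \<tau>" and u: "cmod u = r^2 * \<tau>"
    define z where "z = 2 * \<i> * csqrt u"
    have "- (z^2) / 4 = u" by (simp add: z_def power_mult_distrib)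
    then have "cmod (bessel_entire \<nu> u) \<le> K * exp \<bar>Im z\<bar>" using K(2)[of z] by simp
    also have "\<bar>Im z\<bar> \<le> cmod z" by (rule abs_Im_le_cmod)
    also have "cmod z = 2 * (\<bar>r\<bar> * sqrt \<tau>)"
      by (simp add: z_def norm_mult u real_sqrt_mult)
    finally have 1: "cmod (bessel_entire \<nu> u) \<le> K * exp (2 * (\<bar>r\<bar> * sqrt \<tau>))" using K(1) by simp
    have "0 \<le> (\<bar>r\<bar> - 2 * sqrt \<tau>)^2" by simp
    also have "\<dots> = r^2 - 4 * (\<bar>r\<bar> * sqrt \<tau>) + 4 * \<tau>" using \<tau> by (simp add: power2_diff power_mult_distrib)
    finally have 2: "- (r^2) / 2 + 2 * (\<bar>r\<bar> * sqrt \<tau>) \<le> 2 * \<tau>" by simp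
    have "exp (- (r^2) / 2) * cmod (bessel_entire \<nu> u) \<le> exp (- (r^2) / 2) * (K * exp (2 * (\<bar>r\<bar> * sqrt \<tau>)))"
      using 1 by (intro mult_left_mono) auto
    also have "\<dots> = K * exp (- (r^2) / 2 + 2 * (\<bar>r\<bar> * sqrt \<tau>))" unfolding exp_add by simp
    also have "\<dots> \<le> K * exp (2 * \<tau>)" using 2 K(1) by simp
    finally show "exp (- (r^2) / 2) * cmod (bessel_entire \<nu> u) \<le> K * exp (2 * \<tau>)" .
  qed
qed

lemma measurable_bessel_entire:
  assumes "\<nu> > -1/2"
  shows "bessel_entire \<nu> \<in> borel_measurable borel"
  using continuous_on_bessel_entire[OF assms] by (rule borel_measurable_continuous_onI)

text \<open>The factor exp t is kept outside the integral because at t = z^2/4 the two factors grow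
  differently: one with Re(z^2)/4, the other only with Im z.\<close>

definition laguerre_transform :: "real \<Rightarrow> (real \<Rightarrow> complex) \<Rightarrow> complex \<Rightarrow> complex" where
  "laguerre_transform \<nu> F t = exp t *
     (\<integral>r. F r * (of_real (exp (- (r^2) / 2)) * bessel_entire \<nu> (- (of_real (r^2) * t))) \<partial>hankel_measure \<nu>)"

lemma laguerre_transform_sums:
  assumes nu: "\<nu> > -1/2" and F: "F \<in> borel_measurable borel" "integrable (hankel_measure \<nu>) F"
  shows "(\<lambda>k. (\<integral>r. F r * of_real (laguerre k \<nu> (r^2) * exp (- (r^2) / 2)) \<partial>hankel_measure \<nu>) / of_real (Gamma (real k + \<nu> + 1)) * t ^ k)
    sums laguerre_transform \<nu> F t"
proof -
  note [measurable] = F(1) measurable_bessel_entire[OF nu]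
  obtain K where K: "K > 0" "\<And>r u \<tau>. 0 \<le> \<tau> \<Longrightarrow> cmod u = r^2 * \<tau> \<Longrightarrow> exp (- (r^2) / 2) * cmod (bessel_entire \<nu> u) \<le> K * exp (2 * \<tau>)"
    using gaussian_bessel_entire_bound[OF nu] by metis
  define \<Phi> where "\<Phi> = (\<lambda>k r. F r * of_real (laguerre k \<nu> (r^2) * exp (- (r^2) / 2)) * (t ^ k / of_real (Gamma (real k + \<nu> + 1))))"
  have "(\<lambda>k. integral\<^sup>L (hankel_measure \<nu>) (\<Phi> k)) sums
     integral\<^sup>L (hankel_measure \<nu>) (\<lambda>r. F r * of_real (exp (- (r^2) / 2)) * (exp t * bessel_entire \<nu> (- (of_real (r^2) * t))))"
  proof (rule sums_integral_dominated(2))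
    show "\<Phi> k \<in> borel_measurable (hankel_measure \<nu>)" for k
      unfolding \<Phi>_def laguerre_def by measurable
    show "(\<lambda>r. F r * of_real (exp (- (r^2) / 2)) * (exp t * bessel_entire \<nu> (- (of_real (r^2) * t)))) \<in> borel_measurable (hankel_measure \<nu>)"
      by measurable
    show "integrable (hankel_measure \<nu>) (\<lambda>r. cmod (F r) * (exp (cmod t) * (K * exp (2 * cmod t))))"
      using F(2) by (intro integrable_mult_left integrable_norm)
    show "AE r in hankel_measure \<nu>. (\<lambda>k. \<Phi> k r) sums (F r * of_real (exp (- (r^2) / 2)) * (exp t * bessel_entire \<nu> (- (of_real (r^2) * t))))"
    proof (rule AE_I2)
      fix r
      have "\<Phi> k r = F r * of_real (exp (- (r^2) / 2)) * (of_real (laguerre k \<nu> (r^2) / Gamma (real k + \<nu> + 1)) * t ^ k)" for k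
        by (simp add: \<Phi>_def)
      then show "(\<lambda>k. \<Phi> k r) sums (F r * of_real (exp (- (r^2) / 2)) * (exp t * bessel_entire \<nu> (- (of_real (r^2) * t))))"
        using sums_mult[OF laguerre_generating_function[OF nu, of "r^2" t]] by presburger
    qed
    show "AE r in hankel_measure \<nu>. \<forall>n. (\<Sum>k<n. norm (\<Phi> k r)) \<le> cmod (F r) * (exp (cmod t) * (K * exp (2 * cmod t)))"
    proof (intro AE_I2 allI)
      fix r n
      have "norm (\<Phi> k r) = cmod (F r) * exp (- (r^2) / 2) * (\<bar>laguerre k \<nu> (r^2)\<bar> / Gamma (real k + \<nu> + 1) * cmod t ^ k)" for k
        using Gamma_shift_pos[OF nu, of k]
        by (simp add: \<Phi>_def norm_mult norm_divide norm_power abs_mult)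
      then have "(\<Sum>k<n. norm (\<Phi> k r)) = cmod (F r) * exp (- (r^2) / 2) * (\<Sum>k<n. \<bar>laguerre k \<nu> (r^2)\<bar> / Gamma (real k + \<nu> + 1) * cmod t ^ k)"
        by (simp only: sum_distrib_left)
      also have "\<dots> \<le> cmod (F r) * exp (- (r^2) / 2) * (exp (cmod t) * cmod (bessel_entire \<nu> (of_real (\<bar>r^2\<bar> * cmod t))))"
        by (intro mult_left_mono laguerre_generating_function_bound nu) auto
      also have "\<dots> = cmod (F r) * (exp (cmod t) * (exp (- (r^2) / 2) * cmod (bessel_entire \<nu> (of_real (\<bar>r^2\<bar> * cmod t)))))"
        by (simp add: mult_ac)
      also have "\<dots> \<le> cmod (F r) * (exp (cmod t) * (K * exp (2 * cmod t)))"
        by (intro mult_left_mono K(2)) (auto simp: norm_mult norm_power)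
      finally show "(\<Sum>k<n. norm (\<Phi> k r)) \<le> cmod (F r) * (exp (cmod t) * (K * exp (2 * cmod t)))" .
    qed
  qed
  moreover have "integral\<^sup>L (hankel_measure \<nu>) (\<Phi> k) =
      (\<integral>r. F r * of_real (laguerre k \<nu> (r^2) * exp (- (r^2) / 2)) \<partial>hankel_measure \<nu>) / of_real (Gamma (real k + \<nu> + 1)) * t ^ k" for k
    unfolding \<Phi>_def integral_mult_left_zero by simp
  moreover have "integral\<^sup>L (hankel_measure \<nu>) (\<lambda>r. F r * of_real (exp (- (r^2) / 2)) * (exp t * bessel_entire \<nu> (- (of_real (r^2) * t))))
      = laguerre_transform \<nu> F t"
    unfolding laguerre_transform_def integral_mult_right_zero[symmetric] by (simp add: mult_ac)
  ultimately show ?thesis by simp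
qed

text \<open>The rate 3 is 1 from the factor exp t plus 2 from the Gaussian-weighted Bessel
  kernel.\<close>

lemma laguerre_transform_exponential_bound:
  assumes nu: "\<nu> > -1/2" and F: "integrable (hankel_measure \<nu>) F"
  obtains C where "C > 0" "\<And>t. cmod (laguerre_transform \<nu> F t) \<le> C * exp (3 * cmod t)"
proof -
  obtain K where K: "K > 0" "\<And>r u \<tau>. 0 \<le> \<tau> \<Longrightarrow> cmod u = r^2 * \<tau> \<Longrightarrow> exp (- (r^2) / 2) * cmod (bessel_entire \<nu> u) \<le> K * exp (2 * \<tau>)"
    using gaussian_bessel_entire_bound[OF nu] by metis
  define N where "N = integral\<^sup>L (hankel_measure \<nu>) (\<lambda>r. cmod (F r))"
  have N: "N \<ge> 0" by (simp add: N_def)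
  have "cmod (laguerre_transform \<nu> F t) \<le> (N * K + 1) * exp (3 * cmod t)" for t
  proof -
    have "cmod (\<integral>r. F r * (of_real (exp (- (r^2) / 2)) * bessel_entire \<nu> (- (of_real (r^2) * t))) \<partial>hankel_measure \<nu>)
        \<le> integral\<^sup>L (hankel_measure \<nu>) (\<lambda>r. cmod (F r) * (K * exp (2 * cmod t)))"
    proof (rule norm_integral_le_majorant)
      show "integrable (hankel_measure \<nu>) (\<lambda>r. cmod (F r) * (K * exp (2 * cmod t)))"
        using F by (intro integrable_mult_left integrable_norm)
      have "cmod (F r * (of_real (exp (- (r^2) / 2)) * bessel_entire \<nu> (- (of_real (r^2) * t)))) \<le> cmod (F r) * (K * exp (2 * cmod t))" for r
        using K(2)[of "cmod t" "- (of_real (r^2) * t)" r] unfolding norm_mult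
        by (intro mult_left_mono) (auto simp: norm_mult norm_power)
      then show "AE r in hankel_measure \<nu>. cmod (F r * (of_real (exp (- (r^2) / 2)) * bessel_entire \<nu> (- (of_real (r^2) * t)))) \<le> cmod (F r) * (K * exp (2 * cmod t))"
        by simp
    qed
    also have "\<dots> = N * K * exp (2 * cmod t)" by (simp add: N_def)
    finally have "cmod (laguerre_transform \<nu> F t) \<le> exp (cmod t) * (N * K * exp (2 * cmod t))"
      unfolding laguerre_transform_def norm_mult using norm_exp[of t] N K(1) by (intro mult_mono) auto
    also have "\<dots> = N * K * exp (cmod t + 2 * cmod t)" unfolding exp_add by simp
    also have "\<dots> \<le> (N * K + 1) * exp (3 * cmod t)" by (simp add: algebra_simps)
    finally show ?thesis .
  qed
  then show thesis using N K(1) by (intro that[of "N * K + 1"]) (auto simp: add_nonneg_pos)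
qed

text \<open>By Fubini the Hankel transform moves from F to the kernel. Weber's integral reproduces
  the kernel with t replaced by -t and a factor exp(2t), which together with exp(-t) restores exp t.
  Boundedness of the Bessel function on the real line makes F(r) g(s), up to a constant, a majorant
  for Fubini.\<close>

lemma laguerre_transform_hankel:
  assumes nu: "\<nu> > -1/2" and F: "F \<in> borel_measurable borel" "integrable (hankel_measure \<nu>) F"
  shows "laguerre_transform \<nu> F t =
    laguerre_transform \<nu> (\<lambda>s. \<integral>r. of_real (bessel_norm \<nu> (s * r)) * F r \<partial>hankel_measure \<nu>) (- t)"
proof -
  interpret H: sigma_finite_measure "hankel_measure \<nu>" by (rule sigma_finite_hankel_measure)
  interpret pair_sigma_finite "hankel_measure \<nu>" "hankel_measure \<nu>" ..
  note [measurable] = F(1) measurable_bessel_entire[OF nu] measurable_bessel_norm[OF nu]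
  obtain K where K: "\<And>z. \<bar>bessel_norm \<nu> z\<bar> \<le> K" by (rule abs_bessel_norm_bounded[OF nu]) blast
  define g where "g = (\<lambda>s. of_real (exp (- (s^2) / 2)) * bessel_entire \<nu> (of_real (s^2) * t))"
  have gm [measurable]: "g \<in> borel_measurable borel" unfolding g_def by measurable
  have gi: "integrable (hankel_measure \<nu>) g"
    using bessel_entire_square_integral(1)[OF nu, of "\<lambda>_. 1" 1 t] by (simp add: g_def)
  have prod: "integrable (hankel_measure \<nu> \<Otimes>\<^sub>M hankel_measure \<nu>) (\<lambda>(r, s). F r * g s)"
  proof (rule Fubini_integrable)
    show "(\<lambda>(r, s). F r * g s) \<in> borel_measurable (hankel_measure \<nu> \<Otimes>\<^sub>M hankel_measure \<nu>)" by measurable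
    show "integrable (hankel_measure \<nu>) (\<lambda>r. \<integral>s. norm (case (r, s) of (r, s) \<Rightarrow> F r * g s) \<partial>hankel_measure \<nu>)"
      using F(2) by (simp add: norm_mult)
    show "AE r in hankel_measure \<nu>. integrable (hankel_measure \<nu>) (\<lambda>s. case (r, s) of (r, s) \<Rightarrow> F r * g s)"
      using gi by simp
  qed
  have ker: "integrable (hankel_measure \<nu> \<Otimes>\<^sub>M hankel_measure \<nu>) (\<lambda>(r, s). of_real (bessel_norm \<nu> (s * r)) * F r * g s)"
  proof (rule Bochner_Integration.integrable_bound)
    show "integrable (hankel_measure \<nu> \<Otimes>\<^sub>M hankel_measure \<nu>) (\<lambda>x. K *\<^sub>R (case x of (r, s) \<Rightarrow> F r * g s))"
      using prod by (rule integrable_scaleR_right)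
    show "(\<lambda>(r, s). of_real (bessel_norm \<nu> (s * r)) * F r * g s) \<in> borel_measurable (hankel_measure \<nu> \<Otimes>\<^sub>M hankel_measure \<nu>)"
      by measurable
    have "norm (of_real (bessel_norm \<nu> (s * r)) * F r * g s) \<le> norm (K *\<^sub>R (F r * g s))" for r s
    proof -
      have "\<bar>bessel_norm \<nu> (s * r)\<bar> * (norm (F r) * norm (g s)) \<le> \<bar>K\<bar> * (norm (F r) * norm (g s))"
        using K[of "s * r"] by (intro mult_right_mono) auto
      then show ?thesis by (simp add: norm_mult mult.assoc)
    qed
    then show "AE x in hankel_measure \<nu> \<Otimes>\<^sub>M hankel_measure \<nu>. norm (case x of (r, s) \<Rightarrow> of_real (bessel_norm \<nu> (s * r)) * F r * g s) \<le> norm (K *\<^sub>R (case x of (r, s) \<Rightarrow> F r * g s))"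
      by (intro AE_I2) auto
  qed
  have "(\<integral>s. (\<integral>r. of_real (bessel_norm \<nu> (s * r)) * F r * g s \<partial>hankel_measure \<nu>) \<partial>hankel_measure \<nu>)
      = (\<integral>r. (\<integral>s. of_real (bessel_norm \<nu> (s * r)) * F r * g s \<partial>hankel_measure \<nu>) \<partial>hankel_measure \<nu>)"
    by (rule Fubini_integral[OF ker])
  also have "(\<lambda>r. \<integral>s. of_real (bessel_norm \<nu> (s * r)) * F r * g s \<partial>hankel_measure \<nu>)
      = (\<lambda>r. F r * (exp (2 * t) * of_real (exp (- (r^2) / 2)) * bessel_entire \<nu> (- (of_real (r^2) * t))))"
  proof
    fix r
    have "(\<integral>s. of_real (bessel_norm \<nu> (s * r)) * F r * g s \<partial>hankel_measure \<nu>)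
       = (\<integral>s. F r * (of_real (bessel_norm \<nu> (r * s) * exp (- (s^2) / 2)) * bessel_entire \<nu> (of_real (s^2) * t)) \<partial>hankel_measure \<nu>)"
      by (simp add: g_def mult_ac)
    also have "\<dots> = F r * (exp (2 * t) * of_real (exp (- (r^2) / 2)) * bessel_entire \<nu> (- (of_real (r^2) * t)))"
      by (simp only: integral_mult_right_zero hankel_transform_gaussian_bessel[OF nu])
    finally show "(\<integral>s. of_real (bessel_norm \<nu> (s * r)) * F r * g s \<partial>hankel_measure \<nu>) = \<dots>" .
  qed
  also have "(\<integral>r. F r * (exp (2 * t) * of_real (exp (- (r^2) / 2)) * bessel_entire \<nu> (- (of_real (r^2) * t))) \<partial>hankel_measure \<nu>)
      = exp t * laguerre_transform \<nu> F t"
    unfolding laguerre_transform_def integral_mult_right_zero[symmetric] mult_2 exp_add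
    by (simp add: mult_ac)
  finally have eq: "(\<integral>s. (\<integral>r. of_real (bessel_norm \<nu> (s * r)) * F r \<partial>hankel_measure \<nu>) * g s \<partial>hankel_measure \<nu>) = exp t * laguerre_transform \<nu> F t"
    by simp
  have "laguerre_transform \<nu> (\<lambda>s. \<integral>r. of_real (bessel_norm \<nu> (s * r)) * F r \<partial>hankel_measure \<nu>) (- t)
      = exp (- t) * (exp t * laguerre_transform \<nu> F t)"
    unfolding laguerre_transform_def[of _ _ "- t"] eq[symmetric] g_def by simp
  then show ?thesis by (simp flip: mult.assoc exp_add)
qed

subsection \<open>Bounds for the transform\<close>

lemma entire_power_series_coeff_bound:
  fixes c :: "nat \<Rightarrow> complex"
  assumes sums: "\<And>t. (\<lambda>k. c k * t ^ k) sums \<Phi> t"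
    and \<rho>: "\<rho> > 0" and B: "\<And>t. cmod t = \<rho> \<Longrightarrow> cmod (\<Phi> t) \<le> B"
  shows "cmod (c k) \<le> B / \<rho> ^ k"
proof -
  define P where "P = Abs_fps c"
  have radius: "fps_conv_radius P = \<infinity>"
    unfolding fps_conv_radius_def P_def
  proof (rule conv_radius_inftyI'[of 0])
    fix r :: real assume "r > 0"
    then show "\<exists>z. cmod z = r \<and> summable (\<lambda>n. fps_nth (Abs_fps c) n * z ^ n)"
      using sums by (intro exI[of _ "of_real r"]) (auto simp: sums_iff)
  qed
  have eval: "eval_fps P = \<Phi>"
    using sums by (auto simp: eval_fps_def P_def sums_iff)
  have hol: "\<Phi> holomorphic_on A" for A
    using holomorphic_on_eval_fps[of A P] by (simp add: radius eval eball_inf)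
  have "c k = (deriv ^^ k) \<Phi> 0 / fact k"
    using fps_nth_conv_deriv[of P k] unfolding radius eval by (simp add: P_def)
  moreover have "cmod ((deriv ^^ k) \<Phi> 0) \<le> fact k * B / \<rho> ^ k"
    using hol \<rho> B by (intro Cauchy_inequality holomorphic_on_imp_continuous_on) auto
  then have "cmod ((deriv ^^ k) \<Phi> 0) / fact k \<le> (fact k * B / \<rho> ^ k) / fact k"
    by (rule divide_right_mono) simp
  ultimately show ?thesis by (simp add: norm_divide)
qed

text \<open>On 0 < r \<le> y the measure density times (r y)^(-\<nu>-1/2) equals (r/y)^(\<nu>+1/2)
  \<le> 1. What remains is a Gaussian of unit variance, so the bound does not depend on y.\<close>

lemma integrable_hankel_shifted_gaussian:
  assumes nu: "\<nu> > -1/2" and y: "y > 0"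
  defines "V \<equiv> (\<lambda>r. indicator {0<..y} r * ((r * y) powr (- \<nu> - 1/2) * exp (- ((r - y/2)^2) / 2)) :: real)"
  shows "integrable (hankel_measure \<nu>) V" "integral\<^sup>L (hankel_measure \<nu>) V \<le> sqrt (2 * pi)"
proof -
  define N where "N = (\<lambda>r. sqrt (2 * pi) * normal_density (y/2) 1 r)"
  have N: "integrable lborel N" "integral\<^sup>L lborel N = sqrt (2 * pi)" by (auto simp: N_def)
  have Vm: "V \<in> borel_measurable borel" unfolding V_def by measurable
  have le: "norm (indicator {0<..} r *\<^sub>R (r powr (2 * \<nu> + 1)) *\<^sub>R V r) \<le> N r" for r
  proof (cases "r \<in> {0<..y}")
    case True
    have split: "(r * y) powr (- \<nu> - 1/2) = r powr (- \<nu> - 1/2) * y powr (- \<nu> - 1/2)"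
      using True y by (simp add: powr_mult)
    have "r powr (2 * \<nu> + 1) * (r * y) powr (- \<nu> - 1/2) = r powr (2 * \<nu> + 1 + (- \<nu> - 1/2)) * y powr (- \<nu> - 1/2)"
      by (simp only: split powr_add mult.assoc)
    also have "\<dots> = r powr (\<nu> + 1/2) * y powr (- \<nu> - 1/2)"
      by (simp add: algebra_simps)
    also have "y powr (- \<nu> - 1/2) = inverse (y powr (\<nu> + 1/2))" by (simp flip: powr_minus)
    also have "r powr (\<nu> + 1/2) * inverse (y powr (\<nu> + 1/2)) = (r / y) powr (\<nu> + 1/2)"
      unfolding divide_inverse[symmetric, of "_ powr _"] using True y by (simp add: powr_divide)
    also have "\<dots> \<le> 1" using True y nu by (intro powr_le1) auto
    finally have "r powr (2 * \<nu> + 1) * (r * y) powr (- \<nu> - 1/2) * exp (- ((r - y/2)^2) / 2) \<le> 1 * exp (- ((r - y/2)^2) / 2)"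
      by (intro mult_right_mono) auto
    then show ?thesis using True y
      by (simp add: V_def N_def normal_density_def abs_mult mult.assoc)
  next
    case False
    then have "V r = 0" by (simp add: V_def)
    moreover have "0 \<le> N r" by (simp add: N_def)
    ultimately show ?thesis by simp
  qed
  have int: "set_integrable lborel {0<..} (\<lambda>r. (r powr (2 * \<nu> + 1)) *\<^sub>R V r)"
    unfolding set_integrable_def
  proof (rule Bochner_Integration.integrable_bound[OF N(1)])
    show "(\<lambda>r. indicator {0<..} r *\<^sub>R (r powr (2 * \<nu> + 1)) *\<^sub>R V r) \<in> borel_measurable lborel"
      using Vm by measurable
    show "AE r in lborel. norm (indicator {0<..} r *\<^sub>R (r powr (2 * \<nu> + 1)) *\<^sub>R V r) \<le> norm (N r)"
      using le by (intro AE_I2) (metis abs_ge_self order_trans real_norm_def)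
  qed
  show "integrable (hankel_measure \<nu>) V"
    using int by (simp add: integrable_hankel_measure_iff[OF Vm])
  have "integral\<^sup>L (hankel_measure \<nu>) V = (\<integral>r. indicator {0<..} r *\<^sub>R (r powr (2 * \<nu> + 1)) *\<^sub>R V r \<partial>lborel)"
    by (simp add: integral_hankel_measure[OF Vm] set_lebesgue_integral_def)
  also have "\<dots> \<le> norm \<dots>" by simp
  also have "\<dots> \<le> integral\<^sup>L lborel N"
    using le by (intro norm_integral_le_majorant N(1)) auto
  finally show "integral\<^sup>L (hankel_measure \<nu>) V \<le> sqrt (2 * pi)" using N by simp
qed

text \<open>The decay of the Bessel function in the imaginary direction exactly cancels the growth
  of the measure on the bulk r \<le> y of the integral; without it a polynomial factor
  would remain, which slowly growing weights do not absorb.\<close>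
lemma laguerre_transform_integral_bound:
  assumes nu: "\<nu> > -1/2"
    and v: "\<And>s t. 0 \<le> s \<Longrightarrow> s \<le> t \<Longrightarrow> v s \<le> v t" "\<And>t. 0 \<le> t \<Longrightarrow> 0 \<le> v t" "\<And>t. 0 \<le> t \<Longrightarrow> v t \<le> t^2 / 8 + b"
    and F: "\<And>r. r > 0 \<Longrightarrow> cmod (F r) \<le> C * exp (- (r^2) / 2 + v r)"
  obtains C' where
    "\<And>z. cmod (\<integral>r. F r * (of_real (exp (- (r^2) / 2)) * bessel_entire \<nu> (- (of_real (r^2) * (z^2 / 4)))) \<partial>hankel_measure \<nu>)
      \<le> C' * exp ((Im z)^2 / 4 + v \<bar>Im z\<bar>)"
proof -
  obtain K where K: "K > 0" "\<And>z. cmod (bessel_entire \<nu> (- (z^2) / 4)) \<le> K * exp \<bar>Im z\<bar>"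
    "\<And>z. Im z \<noteq> 0 \<Longrightarrow> cmod (bessel_entire \<nu> (- (z^2) / 4)) \<le> K * exp \<bar>Im z\<bar> * \<bar>Im z\<bar> powr (- \<nu> - 1/2)"
    using bessel_entire_exp_bound[OF nu] by metis
  have "0 \<le> C * exp (- (1^2) / 2 + v 1)" by (rule order_trans[OF norm_ge_zero F]) simp
  then have C: "C \<ge> 0" by (simp add: zero_le_mult_iff)
  define Q where "Q = integral\<^sup>L (hankel_measure \<nu>) (\<lambda>r. exp (- (1/8 * r^2)))"
  have Qi: "integrable (hankel_measure \<nu>) (\<lambda>r. exp (- (1/8 * r^2)))" by (intro integrable_hankel_gaussian nu) simp
  show thesis
  proof (rule that[of "C * K * (sqrt (2 * pi) + exp b * Q)"])
    fix z :: complex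
    define y where "y = \<bar>Im z\<bar>"
    define E where "E = exp (y^2/4 + v y)"
    have y0: "y \<ge> 0" by (simp add: y_def)
    have E0: "E > 0" "exp (y^2/4) \<le> E" using v(2)[OF y0] by (auto simp: E_def)
    define V where "V = (\<lambda>r. indicator {0<..y} r * ((r * y) powr (- \<nu> - 1/2) * exp (- ((r - y/2)^2) / 2)) :: real)"
    have V: "integrable (hankel_measure \<nu>) V" "integral\<^sup>L (hankel_measure \<nu>) V \<le> sqrt (2 * pi)"
    proof -
      have "integrable (hankel_measure \<nu>) V \<and> integral\<^sup>L (hankel_measure \<nu>) V \<le> sqrt (2 * pi)"
      proof (cases "y = 0")
        case True
        then have "V = (\<lambda>_. 0)" by (auto simp: V_def indicator_def)
        then show ?thesis by simp
      next
        case False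
        then show ?thesis using integrable_hankel_shifted_gaussian[OF nu, of y] y0 unfolding V_def by simp
      qed
      then show "integrable (hankel_measure \<nu>) V" "integral\<^sup>L (hankel_measure \<nu>) V \<le> sqrt (2 * pi)" by auto
    qed
    define W where "W = (\<lambda>r. C * K * E * (V r + exp b * exp (- (1/8 * r^2))))"
    have Vn: "V r \<ge> 0" for r by (simp add: V_def)
    have le: "cmod (F r * (of_real (exp (- (r^2) / 2)) * bessel_entire \<nu> (- (of_real (r^2) * (z^2 / 4))))) \<le> W r" if r: "r > 0" for r
    proof -
      define \<beta> where "\<beta> = cmod (bessel_entire \<nu> (- (of_real (r^2) * (z^2 / 4))))"
      have arg: "- (of_real (r^2) * (z^2 / 4)) = - ((of_real r * z)^2) / 4" by (simp add: power_mult_distrib)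
      have Im: "\<bar>Im (of_real r * z)\<bar> = r * y" using r by (simp add: y_def abs_mult)
      have "cmod (F r * (of_real (exp (- (r^2) / 2)) * bessel_entire \<nu> (- (of_real (r^2) * (z^2 / 4)))))
          = cmod (F r) * exp (- (r^2) / 2) * \<beta>" by (simp add: norm_mult \<beta>_def)
      also have "\<dots> \<le> C * exp (- (r^2) / 2 + v r) * exp (- (r^2) / 2) * \<beta>"
        by (intro mult_right_mono F r) (auto simp: \<beta>_def)
      finally have 1: "cmod (F r * (of_real (exp (- (r^2) / 2)) * bessel_entire \<nu> (- (of_real (r^2) * (z^2 / 4)))))
          \<le> C * (exp (- (r^2) + v r) * \<beta>)" by (simp add: mult.assoc mult_ac flip: exp_add)
      \<comment> \<open>The term -r^2 collects two Gaussians, one from the bound on F and one from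
        the kernel; r y is the growth of the Bessel function.\<close>
      have sq: "- (r^2) + r * y = y^2/4 - (r - y/2)^2" by (simp add: power2_diff field_simps)
      have "exp (- (r^2) + v r) * \<beta> \<le> K * E * (V r + exp b * exp (- (1/8 * r^2)))"
      \<comment> \<open>For r \<le> y monotonicity replaces v r by v y, and half of the square
        suffices for the normal density. For r > y one has r - y/2 > r/2, so the square supplies
        r^2/4; the weight consumes r^2/8 and the rest is integrable.\<close>
      proof (cases "r \<le> y")
        case True
        then have y: "y > 0" using r by simp
        have "\<beta> \<le> K * exp (r * y) * (r * y) powr (- \<nu> - 1/2)"
          unfolding \<beta>_def arg using K(3)[of "of_real r * z"] Im y r by (simp add: y_def)
        then have "exp (- (r^2) + v r) * \<beta> \<le> exp (- (r^2) + v r) * (K * exp (r * y) * (r * y) powr (- \<nu> - 1/2))"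
          by (intro mult_left_mono) auto
        also have "\<dots> = K * (exp (- (r^2) + r * y + v r) * (r * y) powr (- \<nu> - 1/2))"
          by (simp only: exp_add mult_ac)
        also have "\<dots> \<le> K * ((E * exp (- ((r - y/2)^2) / 2)) * (r * y) powr (- \<nu> - 1/2))"
        proof (intro mult_left_mono mult_right_mono)
          have "- (r^2) + r * y + v r \<le> (y^2/4 + v y) + (- ((r - y/2)^2) / 2)"
            unfolding sq using v(1)[OF less_imp_le[OF r] True] zero_le_power2[of "r - y/2"] by linarith
          then show "exp (- (r^2) + r * y + v r) \<le> E * exp (- ((r - y/2)^2) / 2)"
            unfolding E_def exp_add[symmetric] by simp
        qed (use K in auto)
        also have "\<dots> = K * E * V r" using r True by (simp add: V_def)
        also have "\<dots> \<le> K * E * (V r + exp b * exp (- (1/8 * r^2)))"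
          using K E0 by (intro mult_left_mono) auto
        finally show ?thesis .
      next
        case False
        have "\<beta> \<le> K * exp (r * y)"
          unfolding \<beta>_def arg using K(2)[of "of_real r * z"] unfolding Im .
        then have "exp (- (r^2) + v r) * \<beta> \<le> exp (- (r^2) + v r) * (K * exp (r * y))"
          by (intro mult_left_mono) auto
        also have "\<dots> = K * exp (- (r^2) + r * y + v r)" by (simp only: exp_add mult_ac)
        also have "\<dots> \<le> K * (E * (exp b * exp (- (1/8 * r^2))))"
        proof (intro mult_left_mono)
          have "(r/2)^2 \<le> (r - y/2)^2" using False r y0 by (intro power_mono) auto
          then have "- (r^2) + r * y + v r \<le> y^2/4 + b + - (1/8 * r^2)"
            unfolding sq using v(3)[of r] r by (simp add: power_divide)
          then have "exp (- (r^2) + r * y + v r) \<le> exp (y^2/4) * (exp b * exp (- (1/8 * r^2)))"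
            unfolding exp_add[symmetric] by (simp add: add.assoc)
          also have "\<dots> \<le> E * (exp b * exp (- (1/8 * r^2)))" using E0 by (intro mult_right_mono) auto
          finally show "exp (- (r^2) + r * y + v r) \<le> E * (exp b * exp (- (1/8 * r^2)))" .
        qed (use K in auto)
        also have "\<dots> \<le> K * E * (V r + exp b * exp (- (1/8 * r^2)))"
          using K E0 Vn[of r] by (simp add: mult.assoc)
        finally show ?thesis .
      qed
      then have "C * (exp (- (r^2) + v r) * \<beta>) \<le> W r"
        unfolding W_def using C by (simp add: mult_left_mono mult.assoc)
      then show ?thesis using 1 by linarith
    qed
    have "cmod (\<integral>r. F r * (of_real (exp (- (r^2) / 2)) * bessel_entire \<nu> (- (of_real (r^2) * (z^2 / 4)))) \<partial>hankel_measure \<nu>) \<le> integral\<^sup>L (hankel_measure \<nu>) W"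
    proof (rule norm_integral_le_majorant)
      show "integrable (hankel_measure \<nu>) W" unfolding W_def using V(1) Qi by (intro integrable_mult_right Bochner_Integration.integrable_add) auto
      show "AE r in hankel_measure \<nu>. cmod (F r * (of_real (exp (- (r^2) / 2)) * bessel_entire \<nu> (- (of_real (r^2) * (z^2 / 4))))) \<le> W r"
        using AE_hankel_measure_pos by eventually_elim (rule le)
    qed
    also have "integral\<^sup>L (hankel_measure \<nu>) W = C * K * E * (integral\<^sup>L (hankel_measure \<nu>) V + exp b * Q)"
      unfolding W_def Q_def using V(1) Qi by simp
    also have "\<dots> \<le> C * K * E * (sqrt (2 * pi) + exp b * Q)"
      using C K E0 V(2) by (intro mult_left_mono) auto
    finally show "cmod (\<integral>r. F r * (of_real (exp (- (r^2) / 2)) * bessel_entire \<nu> (- (of_real (r^2) * (z^2 / 4)))) \<partial>hankel_measure \<nu>)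
      \<le> C * K * (sqrt (2 * pi) + exp b * Q) * exp ((Im z)^2 / 4 + v \<bar>Im z\<bar>)"
      by (simp add: E_def y_def mult_ac)
  qed
qed

text \<open>Logarithms turn the family of bounds into an upper bound for the supremum. For A > 0
  this also shows that the conjugate is finite; an infinite conjugate, where \<open>eexp\<close> is
  0, is therefore possible only for A \<le> 0.\<close>

lemma le_young_conj_bound:
  fixes A B e l V :: real
  assumes "B \<ge> 0" "l > 0" and le: "\<And>u. u \<ge> 0 \<Longrightarrow> A \<le> B * exp (e - (u * V - \<phi> u) / l)"
  shows "ereal A \<le> ereal B * eexp (ereal e - ereal (1/l) * young_conj \<phi> V)"
proof (cases "A \<le> 0")
  case True
  then have "ereal A \<le> 0" by simp
  also have "0 \<le> ereal B * eexp (ereal e - ereal (1/l) * young_conj \<phi> V)"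
    using assms(1) by (intro ereal_0_le_mult) (auto simp: eexp_def)
  finally show ?thesis .
next
  case False
  then have A: "A > 0" by simp
  have B: "B > 0" using le[of 0] A assms(1) by (cases "B = 0") auto
  \<comment> \<open>The value of the conjugate at which the asserted bound would be an
    equality.\<close>
  define T where "T = l * (e - ln (A / B))"
  have "ereal (u * V - \<phi> u) \<le> ereal T" if "u \<ge> 0" for u
  proof -
    have "A / B \<le> exp (e - (u * V - \<phi> u) / l)" using le[OF that] B by (simp add: field_simps)
    then have "ln (A / B) \<le> ln (exp (e - (u * V - \<phi> u) / l))" using A B by (intro ln_mono) auto
    then have "ln (A / B) \<le> e - (u * V - \<phi> u) / l" by simp
    then show ?thesis using assms(2) by (simp add: T_def field_simps)
  qed
  then have "young_conj \<phi> V \<le> ereal T" unfolding young_conj_def by (intro SUP_least) auto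
  moreover have "ereal (0 * V - \<phi> 0) \<le> young_conj \<phi> V" unfolding young_conj_def by (intro SUP_upper) auto
  ultimately obtain Y where Y: "young_conj \<phi> V = ereal Y" "Y \<le> T" by (cases "young_conj \<phi> V") auto
  have "A / B = exp (e - T / l)" using A B assms(2) by (simp add: T_def)
  also have "\<dots> \<le> exp (e - Y / l)" using Y(2) assms(2) by (simp add: divide_right_mono)
  finally have "A \<le> B * exp (e - Y / l)" using B by (simp add: field_simps)
  then show ?thesis by (simp add: Y(1) eexp_def)
qed

text \<open>On each circle of radius R the weight is majorized by the real part of a holomorphic
  function built from a power with exponent a < 2, so no harmonic extension of the weight
  is needed.\<close>
lemma entire_weight_bound:
  fixes \<Psi> :: "complex \<Rightarrow> complex"
  assumes hol: "\<Psi> holomorphic_on UNIV"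
    and bx: "\<And>z. cmod (\<Psi> z) \<le> C * exp ((Re z)^2 / 4 + v \<bar>Im z\<bar>)"
    and b\<^sub>y: "\<And>z. cmod (\<Psi> z) \<le> C * exp ((Im z)^2 / 4 + v \<bar>Re z\<bar>)"
    and v: "\<And>s t. 0 \<le> s \<Longrightarrow> s \<le> t \<Longrightarrow> v s \<le> v t" "\<And>t. 0 \<le> t \<Longrightarrow> 0 \<le> v t"
    and D: "D \<ge> 1" "0 < a" "a < 2" "x\<^sub>0 > 0"
    and gr: "\<And>x t. x\<^sub>0 \<le> x \<Longrightarrow> x \<le> t \<Longrightarrow> v t \<le> D * v x * (t / x) powr a"
  obtains C' L where "C' > 0" "L > 0" "\<And>z. cmod (\<Psi> z) \<le> C' * exp (L * v (cmod z))"
proof -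
  define \<kappa> where "\<kappa> = cos (a * arctan 1)"
  have ang: "a * arctan 1 < pi/2" using D pi_gt_zero by (simp add: arctan_one)
  have \<kappa>: "\<kappa> > 0" unfolding \<kappa>_def using D ang pi_gt_zero
    by (intro cos_gt_zero_pi) (auto simp: arctan_one intro: less_trans[of _ 0])
  \<comment> \<open>On the circle of radius R the auxiliary \<rho> has modulus at most 1 + sqrt 2
    \<le> 3, and 3 to the power a is at most 9.\<close>
  define L where "L = D * (1 + 9 / \<kappa>)"
  have L: "L > 0" unfolding L_def using D \<kappa> by (intro mult_pos_pos add_pos_pos) auto
  have "0 \<le> C * exp ((Re 0)^2 / 4 + v \<bar>Im 0\<bar>)" by (rule order_trans[OF norm_ge_zero bx])
  then have C: "C \<ge> 0" by (simp add: zero_le_mult_iff)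
  \<comment> \<open>Multiplication by \<omega> carries the first quadrant to any other one. It
    preserves or exchanges |Re z| and |Im z|, hence preserves the pair of bounds.\<close>
  have quad: "cmod (\<Psi> (\<omega> * z)) \<le> C * exp (L * v R)"
    if \<omega>: "\<omega> \<in> {1, \<i>, -1, -\<i>}" and R: "R \<ge> x\<^sub>0" and z: "cmod z = R" "0 \<le> Re z" "0 \<le> Im z" for \<omega> z R
  proof -
    have R0: "R > 0" using R D by simp
    define M where "M = D * v R"
    have M0: "M \<ge> 0" "v R \<le> M" using D v(2)[of R] R0 by (auto simp: M_def mult_le_cancel_right1)
    have vM: "v t \<le> M * (1 + (s / R) powr a)" if "0 \<le> t" "t \<le> s" for s t
    proof (cases "t \<le> R")
      case True
      then have "v t \<le> M" using v(1)[of t R] that M0 by simp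
      also have "\<dots> \<le> M * (1 + (s / R) powr a)" using M0 by (simp add: algebra_simps)
      finally show ?thesis .
    next
      case False
      then have "v t \<le> M * (t / R) powr a" using gr[of R t] R by (simp add: M_def)
      also have "\<dots> \<le> M * (s / R) powr a"
        using M0 that R0 D by (intro mult_left_mono powr_mono2 divide_right_mono) auto
      also have "\<dots> \<le> M * (1 + (s / R) powr a)" using M0 by (simp add: algebra_simps)
      finally show ?thesis .
    qed
    \<comment> \<open>Up to scale a rotation by -pi/4, placing the quadrant in |arg| \<le> pi/4,
      where the power a < 2 keeps its argument below pi/2. Adding 1 removes the branch point, and
      dividing by R makes \<rho> of bounded size on the circle in question.\<close>
    define \<rho> where "\<rho> = (\<lambda>z::complex. 1 + Complex 1 (-1) * z / of_real R)"
    have \<rho>Re: "Re (\<rho> z) = 1 + (Re z + Im z) / R" "Im (\<rho> z) = (Im z - Re z) / R" for z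
      by (simp_all add: \<rho>_def)
    \<comment> \<open>Its real part dominates v(|Re z|) and v(|Im z|) throughout the quadrant, yet
      costs only a multiple of v R at |z| = R, the only place where the result is used.\<close>
    define h where "h = (\<lambda>z. of_real M * (1 + \<rho> z powr of_real a / of_real \<kappa>))"
    have Reh: "Re (h z) = M * (1 + Re (\<rho> z powr of_real a) / \<kappa>)" for z by (simp add: h_def)
    have Reh_ge: "M * (1 + (cmod z / R) powr a) \<le> Re (h z)" if "0 \<le> Re z" "0 \<le> Im z" for z
    proof -
      have 1: "Re (\<rho> z) > 0" unfolding \<rho>Re using that R0 by (intro add_pos_nonneg) auto
      have "\<bar>(Im z - Re z) / R\<bar> \<le> (Re z + Im z) / R"
        using that R0 by (auto simp: abs_divide intro!: divide_right_mono)
      then have 2: "\<bar>Im (\<rho> z)\<bar> \<le> 1 * Re (\<rho> z)" unfolding \<rho>Re by simp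
      have "(cmod z / R)^2 \<le> (cmod (\<rho> z))^2"
      proof -
        have e1: "(cmod (\<rho> z))^2 = 1 + 2 * ((Re z + Im z) / R) + 2 * ((Re z / R)^2 + (Im z / R)^2)"
          unfolding cmod_power2 \<rho>Re using R0 by (simp add: power2_eq_square field_simps)
        have e2: "(cmod z / R)^2 = (Re z / R)^2 + (Im z / R)^2"
          by (simp add: power_divide cmod_power2 add_divide_distrib)
        have "0 \<le> (Re z + Im z) / R" using that R0 by simp
        moreover have "0 \<le> (Re z / R)^2 + (Im z / R)^2" by simp
        moreover have "Q \<le> 1 + 2 * t + 2 * Q" if "0 \<le> t" "0 \<le> Q" for t Q :: real
          using that by linarith
        ultimately show ?thesis unfolding e1 e2 by blast
      qed
      then have 3: "cmod z / R \<le> cmod (\<rho> z)" by (rule power2_le_imp_le) simp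
      have "\<kappa> * (cmod z / R) powr a \<le> \<kappa> * cmod (\<rho> z) powr a"
        using 3 \<kappa> D R0 by (intro mult_left_mono powr_mono2) auto
      also have "\<dots> \<le> Re (\<rho> z powr of_real a)"
        unfolding \<kappa>_def by (rule Re_powr_ge_sector[OF 1 2 D(2) ang])
      finally have "(cmod z / R) powr a \<le> Re (\<rho> z powr of_real a) / \<kappa>" using \<kappa> by (simp add: field_simps)
      then show ?thesis unfolding Reh using M0 by (intro mult_left_mono) auto
    qed
    define G where "G = (\<lambda>z. \<Psi> (\<omega> * z) * exp (- h z))"
    have normG: "cmod (G z) = cmod (\<Psi> (\<omega> * z)) * exp (- Re (h z))" for z
      by (simp add: G_def norm_mult)
    \<comment> \<open>The open half-plane where Re \<rho> > 0, so that h is holomorphic around the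
      closed quadrant.\<close>
    define U where "U = {z. - R < Re z + Im z}"
    have \<Psi>\<omega>: "cmod (\<Psi> (\<omega> * z)) \<le> C * exp ((Re z)^2 / 4 + v \<bar>Im z\<bar>)" "cmod (\<Psi> (\<omega> * z)) \<le> C * exp ((Im z)^2 / 4 + v \<bar>Re z\<bar>)" for z
      using \<omega> bx[of "\<omega> * z"] b\<^sub>y[of "\<omega> * z"] by auto
    have absorb: "cmod (\<Psi> (\<omega> * z)) * exp (- Re (h z)) \<le> C * exp E"
      if "cmod (\<Psi> (\<omega> * z)) \<le> C * exp (E + v t)" "0 \<le> t" "t \<le> cmod z" "0 \<le> Re z" "0 \<le> Im z" for z E t
    proof -
      have "v t \<le> Re (h z)" using vM[OF that(2,3)] Reh_ge[OF that(4,5)] by linarith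
      have "cmod (\<Psi> (\<omega> * z)) * exp (- Re (h z)) \<le> C * exp (E + v t) * exp (- Re (h z))"
        using that(1) by (intro mult_right_mono) auto
      also have "\<dots> = C * exp (E + v t - Re (h z))" by (simp add: mult.assoc flip: exp_add)
      also have "\<dots> \<le> C * exp E" using C \<open>v t \<le> Re (h z)\<close> by (intro mult_left_mono) auto
      finally show ?thesis .
    qed
    have "cmod (G z) \<le> C"
    proof (rule Phragmen_Lindelof_quadrant[of G U C z])
      have nonneg: "\<rho> z \<notin> \<real>\<^sub>\<le>\<^sub>0" if "z \<in> U" for z
      proof -
        have "Re (\<rho> z) > 0" unfolding \<rho>Re using that R0 by (simp add: U_def field_simps)
        then show ?thesis by (auto simp: complex_nonpos_Reals_iff)
      qed
      have "\<rho> holomorphic_on U" unfolding \<rho>_def using R0 by (intro holomorphic_intros) auto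
      then have "h holomorphic_on U" unfolding h_def using nonneg \<kappa> by (intro holomorphic_intros) auto
      moreover have "(\<lambda>z. \<Psi> (\<omega> * z)) holomorphic_on U"
        using holomorphic_on_compose_gen[of "\<lambda>z. \<omega> * z" U \<Psi> UNIV] hol
        by (auto simp: o_def intro!: holomorphic_intros)
      ultimately show "G holomorphic_on U" unfolding G_def by (intro holomorphic_intros)
      show "open U" unfolding U_def by (intro open_Collect_less continuous_intros)
      show "{z. 0 \<le> Re z \<and> 0 \<le> Im z} \<subseteq> U" using R0 by (auto simp: U_def)
      fix z assume zz: "0 \<le> Re z" "0 \<le> Im z"
      show "cmod (G z) \<le> C * exp ((Re z)^2 / 4)"
        unfolding normG by (rule absorb[OF \<Psi>\<omega>(1)]) (use zz abs_Im_le_cmod[of z] in auto)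
      show "cmod (G z) \<le> C * exp ((Im z)^2 / 4)"
        unfolding normG by (rule absorb[OF \<Psi>\<omega>(2)]) (use zz abs_Re_le_cmod[of z] in auto)
    qed (use z in auto)
    then have "cmod (\<Psi> (\<omega> * z)) \<le> C * exp (Re (h z))"
      unfolding normG by (simp add: exp_minus field_simps)
    also have "Re (h z) \<le> L * v R"
    proof -
      have "cmod (\<rho> z) \<le> 1 + cmod (Complex 1 (-1) * z / of_real R)"
        unfolding \<rho>_def by (metis norm_one norm_triangle_ineq)
      also have "cmod (Complex 1 (-1) * z / of_real R) = sqrt 2"
        using z R0 by (simp add: norm_mult norm_divide cmod_def[of "Complex _ _"])
      also have "1 + sqrt 2 \<le> 3" using real_sqrt_le_mono[of 2 4] by simp
      finally have "cmod (\<rho> z) powr a \<le> 3 powr a" using D by (intro powr_mono2) auto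
      also have "\<dots> \<le> 3 powr 2" using D by (intro powr_mono) auto
      finally have "Re (\<rho> z powr of_real a) \<le> 9"
        using complex_Re_le_cmod[of "\<rho> z powr of_real a"] by (simp add: norm_powr_real_powr')
      then have "Re (h z) \<le> M * (1 + 9 / \<kappa>)"
        unfolding Reh using M0 \<kappa> by (intro mult_left_mono add_left_mono divide_right_mono) auto
      then show ?thesis by (simp add: L_def M_def mult_ac)
    qed
    finally show ?thesis using C by (simp add: mult_left_mono)
  qed
  have big: "cmod (\<Psi> z) \<le> C * exp (L * v (cmod z))" if "cmod z \<ge> x\<^sub>0" for z
  proof -
    consider "0 \<le> Re z" "0 \<le> Im z" | "Re z \<le> 0" "0 \<le> Im z" | "Re z \<le> 0" "Im z \<le> 0" | "0 \<le> Re z" "Im z \<le> 0"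
      by linarith
    then show ?thesis
    proof cases
      case 1 then show ?thesis using quad[of 1 "cmod z" z] that by simp
    next
      case 2 then show ?thesis using quad[of \<i> "cmod z" "-\<i> * z"] that by (simp add: norm_mult flip: mult.assoc)
    next
      case 3 then show ?thesis using quad[of "-1" "cmod z" "- z"] that by simp
    next
      case 4 then show ?thesis using quad[of "-\<i>" "cmod z" "\<i> * z"] that by (simp add: norm_mult flip: mult.assoc)
    qed
  qed
  have "compact (\<Psi> ` cball 0 x\<^sub>0)"
    using hol by (intro compact_continuous_image holomorphic_on_imp_continuous_on) (auto intro: holomorphic_on_subset)
  then obtain B where B: "B > 0" "\<And>z. cmod z \<le> x\<^sub>0 \<Longrightarrow> cmod (\<Psi> z) \<le> B"
    by (auto dest!: compact_imp_bounded simp: bounded_pos)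
  show thesis
  proof (rule that[of "C + B" L])
    show "C + B > 0" "L > 0" using C B L by auto
    fix z
    have e: "1 \<le> exp (L * v (cmod z))" using L v(2)[of "cmod z"] by simp
    show "cmod (\<Psi> z) \<le> (C + B) * exp (L * v (cmod z))"
    proof (cases "cmod z \<ge> x\<^sub>0")
      case True
      have "C * exp (L * v (cmod z)) \<le> (C + B) * exp (L * v (cmod z))" using B by (intro mult_right_mono) auto
      then show ?thesis using big[OF True] by linarith
    next
      case False
      have "B * 1 \<le> (C + B) * exp (L * v (cmod z))" using B C e by (intro mult_mono) auto
      then show ?thesis using B(2)[of z] False by simp
    qed
  qed
qed

subsection \<open>Bounds for the Laguerre coefficients\<close>

text \<open>In the variable t = z^2/4 the radius is exp(2u)/(4 q^2). Its inverse k-th power supplies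
  2^(2k), exp(2k ln q) and exp(-2ku), and \<phi>(u)/l - 2ku equals -(u (2lk) - \<phi>(u))/l.\<close>

lemma laguerre_coefficient_young_bound:
  fixes a :: "nat \<Rightarrow> complex"
  assumes nu: "\<nu> > -1/2" and q: "q > 0" and l: "l > 0" and C: "C \<ge> 0"
    and sums: "\<And>t. (\<lambda>k. a k / of_real (Gamma (real k + \<nu> + 1)) * t ^ k) sums \<Phi> t"
    and bound: "\<And>u z. u \<ge> 0 \<Longrightarrow> cmod z = exp u / q \<Longrightarrow> cmod (\<Phi> (z^2 / 4)) \<le> C * exp (\<phi> u / l)"
  shows "ereal (cmod (a k)) \<le> ereal (C * 2^(2*k) * Gamma (real k + \<nu> + 1)) *
    eexp (ereal (2 * real k * ln q) - ereal (1/l) * young_conj \<phi> (2 * l * real k))"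
proof (rule le_young_conj_bound)
  have G: "Gamma (real k + \<nu> + 1) > 0" by (rule Gamma_shift_pos[OF nu])
  show "0 \<le> C * 2^(2*k) * Gamma (real k + \<nu> + 1)" using C G by simp
  show "l > 0" by fact
  fix u :: real assume u: "u \<ge> 0"
  define R where "R = exp u / q"
  have R: "R > 0" using q by (simp add: R_def)
  have "cmod (a k / of_real (Gamma (real k + \<nu> + 1))) \<le> C * exp (\<phi> u / l) / (R^2 / 4) ^ k"
  proof (rule entire_power_series_coeff_bound[OF sums])
    show "0 < R^2 / 4" using R by simp
    fix t :: complex assume t: "cmod t = R^2 / 4"
    \<comment> \<open>Every t on the circle is z^2/4 for z = 2 \<open>csqrt t\<close>.\<close>
    have "cmod (2 * csqrt t) = exp u / q"
      using q by (simp add: norm_mult t real_sqrt_divide R_def)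
    from bound[OF u this] show "cmod (\<Phi> t) \<le> C * exp (\<phi> u / l)"
      by (simp add: power_mult_distrib)
  qed
  then have "cmod (a k) \<le> C * exp (\<phi> u / l) * (1 / (R^2 / 4) ^ k) * Gamma (real k + \<nu> + 1)"
    using G by (simp add: norm_divide pos_divide_le_eq)
  also have "1 / (R^2 / 4) ^ k = 2^(2*k) * exp (2 * real k * ln q - 2 * real k * u)"
  proof -
    have "exp (2 * real k * ln q - 2 * real k * u) = (exp (2 * (ln q - u))) ^ k"
      by (simp add: exp_of_nat_mult[symmetric] algebra_simps)
    also have "exp (2 * (ln q - u)) = (exp (ln q - u))^2" by (rule exp_double)
    also have "exp (ln q - u) = 1 / R" using q by (simp add: exp_diff R_def)
    finally show ?thesis using R by (simp add: power_mult power_divide)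
  qed
  also have "C * exp (\<phi> u / l) * (2^(2*k) * exp (2 * real k * ln q - 2 * real k * u)) * Gamma (real k + \<nu> + 1)
      = C * 2^(2*k) * Gamma (real k + \<nu> + 1) * exp (\<phi> u / l + (2 * real k * ln q - 2 * real k * u))"
    by (simp only: exp_add mult_ac)
  also have "\<phi> u / l + (2 * real k * ln q - 2 * real k * u) = 2 * real k * ln q - (u * (2 * l * real k) - \<phi> u) / l"
    using l by (simp add: field_simps)
  finally show "cmod (a k) \<le> C * 2^(2*k) * Gamma (real k + \<nu> + 1) * exp (2 * real k * ln q - (u * (2 * l * real k) - \<phi> u) / l)" .
qed

theorem theorem5p1:
  fixes \<nu> p q lam :: real and w :: "real \<Rightarrow> real" and f :: "real \<Rightarrow> complex"
  assumes nu: "\<nu> > -1/2"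
    and pos: "p > 0" "q > 0" "lam > 0"
    and w: "weight_function w"
    and wint: "\<forall>\<^sub>F x in at_top. set_integrable lborel {x..} (\<lambda>t. w t / t^3)"
    and wO: "(\<lambda>x. LINT t:{x..}|lborel. w t / t^3) \<in> O[at_top](\<lambda>x. w x / x^2)"
    and f: "f \<in> E_H \<nu> p q lam w"
  shows
    "(p \<ge> 1 \<longrightarrow> (\<exists>l>0. \<exists>C>0. \<forall>k::nat.
        ereal (cmod (hinner \<nu> f (laguerre_fun \<nu> k))) \<le>
          ereal (C * 2^(2*k) * Gamma (real k + \<nu> + 1)) *
          eexp (ereal (2 * real k * ln q) -
                ereal (1/l) * young_conj (\<lambda>t. w (exp t)) (2 * l * real k))))
     \<and> (p < 1 \<longrightarrow> (\<exists>l>0. \<exists>C>0. \<forall>k::nat.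
        ereal (cmod (hinner \<nu> f (laguerre_fun \<nu> k))) \<le>
          ereal (C * 2^(2*k) * Gamma (real k + \<nu> + 1)) *
          eexp (ereal (2 * real k * ln q) -
                ereal (1/l) * young_conj
                  (\<lambda>t. 1 / (4 * q^2) * sqrt ((1 - p) / (1 + p)) * exp (2 * t) + w (exp t))
                  (2 * l * real k))))"
proof -
  from f obtain C where L: "L1L2 \<nu> f" and C: "C > 0"
    and fb: "\<And>r. r > 0 \<Longrightarrow> cmod (f r) \<le> C * exp (- p * r^2 / 2 + lam * w (q * r))"
    and Hb: "\<And>s. s > 0 \<Longrightarrow> cmod (hankel \<nu> f s) \<le> C * exp (- p * s^2 / 2 + lam * w (q * s))"
    unfolding E_H_def by blast
  \<comment> \<open>As f is measurable only on the positive half-line, it is cut off there;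
    integrals against \<open>hankel_measure\<close> do not change.\<close>
  define F where "F = (\<lambda>r. indicator {0<..} r *\<^sub>R f r)"
  have Fm: "F \<in> borel_measurable borel"
    using L by (simp add: L1L2_def set_borel_measurable_def F_def)
  have "set_integrable lborel {0<..} (\<lambda>r. (r powr (2 * \<nu> + 1)) *\<^sub>R F r)"
    using L unfolding L1L2_def set_integrable_def
    by (auto simp: F_def indicator_def if_distrib cong: if_cong elim!: back_subst[where P = "integrable lborel"])
  then have Fi: "integrable (hankel_measure \<nu>) F"
    by (simp add: integrable_hankel_measure_iff[OF Fm])
  have inner: "hinner \<nu> f (laguerre_fun \<nu> k) = (\<integral>r. F r * of_real (laguerre k \<nu> (r^2) * exp (- (r^2) / 2)) \<partial>hankel_measure \<nu>)" for k
  proof (subst integral_hankel_measure)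
    show "(\<lambda>r. F r * of_real (laguerre k \<nu> (r^2) * exp (- (r^2) / 2))) \<in> borel_measurable borel"
      unfolding laguerre_def using Fm by measurable
  qed (auto simp: hinner_def laguerre_fun_def F_def intro!: set_lebesgue_integral_cong)
  have hank: "hankel \<nu> f s = (\<integral>r. of_real (bessel_norm \<nu> (s * r)) * F r \<partial>hankel_measure \<nu>)" for s
  proof (subst integral_hankel_measure)
    show "(\<lambda>r. of_real (bessel_norm \<nu> (s * r)) * F r) \<in> borel_measurable borel"
      using Fm measurable_bessel_norm[OF nu] by measurable
  qed (auto simp: hankel_def F_def scaleR_conv_of_real mult_ac intro!: set_lebesgue_integral_cong)
  define \<Phi> where "\<Phi> = laguerre_transform \<nu> F"
  have sums: "(\<lambda>k. hinner \<nu> f (laguerre_fun \<nu> k) / of_real (Gamma (real k + \<nu> + 1)) * t ^ k) sums \<Phi> t" for t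
    unfolding inner \<Phi>_def by (rule laguerre_transform_sums[OF nu Fm Fi])
  show ?thesis
  proof (intro conjI impI)
    assume "p < 1"
    define \<sigma> where "\<sigma> = sqrt ((1 - p) / (1 + p))"
    have \<sigma>: "\<sigma> > 0" using \<open>p < 1\<close> pos by (simp add: \<sigma>_def)
    \<comment> \<open>Chosen so that the quadratic term of \<zeta> divided by l is 3 exp(2u)/(4
      q^2), which is 3|t| on the circle; the nonnegative weight is then added.\<close>
    define l where "l = \<sigma> / 3"
    have l: "l > 0" using \<sigma> by (simp add: l_def)
    obtain B where B: "B > 0" "\<And>t. cmod (\<Phi> t) \<le> B * exp (3 * cmod t)"
      unfolding \<Phi>_def by (rule laguerre_transform_exponential_bound[OF nu Fi]) blast+
    have bound: "cmod (\<Phi> (z^2 / 4)) \<le> B * exp ((1 / (4 * q^2) * \<sigma> * exp (2 * u) + w (exp u)) / l)"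
      if "u \<ge> 0" "cmod z = exp u / q" for u z
    proof -
      have "exp (2 * u) = (exp u)^2" by (rule exp_double)
      then have "3 * cmod (z^2 / 4) = 1 / (4 * q^2) * \<sigma> * exp (2 * u) / l"
        using \<sigma> that(2) by (simp add: l_def norm_divide norm_power power_divide)
      also have "\<dots> \<le> (1 / (4 * q^2) * \<sigma> * exp (2 * u) + w (exp u)) / l"
        using l weight_function_nonneg[OF w, of "exp u"] by (intro divide_right_mono) auto
      finally have "B * exp (3 * cmod (z^2 / 4)) \<le> B * exp ((1 / (4 * q^2) * \<sigma> * exp (2 * u) + w (exp u)) / l)"
        using B(1) by simp
      then show ?thesis using B(2)[of "z^2/4"] by linarith
    qed
    show "\<exists>l>0. \<exists>C>0. \<forall>k::nat.
        ereal (cmod (hinner \<nu> f (laguerre_fun \<nu> k))) \<le>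
          ereal (C * 2^(2*k) * Gamma (real k + \<nu> + 1)) *
          eexp (ereal (2 * real k * ln q) -
                ereal (1/l) * young_conj
                  (\<lambda>t. 1 / (4 * q^2) * sqrt ((1 - p) / (1 + p)) * exp (2 * t) + w (exp t))
                  (2 * l * real k))"
      unfolding \<sigma>_def[symmetric]
      by (intro exI[of _ l] exI[of _ B] conjI allI l B(1)
            laguerre_coefficient_young_bound[OF nu pos(2) l less_imp_le[OF B(1)] sums bound])
  next
    assume "p \<ge> 1"
    obtain D a x0 where D: "D \<ge> 1" "0 < a" "a < 2" "x0 > 0"
      and gr: "\<And>x t. x0 \<le> x \<Longrightarrow> x \<le> t \<Longrightarrow> w t \<le> D * w x * (t / x) powr a"
      by (rule weight_function_power_growth[OF w wint wO]) blast+
    define v where "v = (\<lambda>r. lam * w (q * r))"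
    have v1: "v s \<le> v t" if "0 \<le> s" "s \<le> t" for s t
      unfolding v_def using that pos by (intro mult_left_mono weight_function_mono[OF w]) auto
    have v2: "0 \<le> v t" if "0 \<le> t" for t
      unfolding v_def using that pos weight_function_nonneg[OF w] by auto
    \<comment> \<open>Rescaled by q and multiplied by \<open>lam\<close>, this coefficient gives v t
      \<le> t^2/8 + const.\<close>
    have e: "1 / (8 * lam * q^2) > 0" using pos by simp
    obtain K where K: "\<And>t. t \<ge> 0 \<Longrightarrow> w t \<le> 1 / (8 * lam * q^2) * t^2 + K"
      by (rule weight_function_quadratic_bound[OF w D gr e]) blast+
    have v3: "v t \<le> t^2 / 8 + lam * K" if "0 \<le> t" for t
    proof -
      have "v t \<le> lam * (1 / (8 * lam * q^2) * (q * t)^2 + K)"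
        unfolding v_def using K[of "q * t"] that pos by (intro mult_left_mono) auto
      also have "\<dots> = t^2 / 8 + lam * K" using pos by (simp add: field_simps)
      finally show ?thesis .
    qed
    have p1: "C * exp (- p * r^2 / 2 + v r) \<le> C * exp (- (r^2) / 2 + v r)" for r
    proof -
      have "1 * r^2 \<le> p * r^2" using \<open>p \<ge> 1\<close> by (intro mult_right_mono) auto
      then show ?thesis using C by simp
    qed
    have Fb: "cmod (F r) \<le> C * exp (- (r^2) / 2 + v r)" if "r > 0" for r
      using fb[OF that] p1[of r] that by (simp add: F_def v_def)
    have HFb: "cmod (hankel \<nu> f r) \<le> C * exp (- (r^2) / 2 + v r)" if "r > 0" for r
      using Hb[OF that] p1[of r] by (simp add: v_def)
    obtain C1 where C1: "\<And>z. cmod (\<integral>r. F r * (of_real (exp (- (r^2) / 2)) * bessel_entire \<nu> (- (of_real (r^2) * (z^2 / 4)))) \<partial>hankel_measure \<nu>)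
        \<le> C1 * exp ((Im z)^2 / 4 + v \<bar>Im z\<bar>)"
      by (rule laguerre_transform_integral_bound[OF nu v1 v2 v3 Fb]) blast+
    obtain C2 where C2: "\<And>z. cmod (\<integral>r. hankel \<nu> f r * (of_real (exp (- (r^2) / 2)) * bessel_entire \<nu> (- (of_real (r^2) * (z^2 / 4)))) \<partial>hankel_measure \<nu>)
        \<le> C2 * exp ((Im z)^2 / 4 + v \<bar>Im z\<bar>)"
      by (rule laguerre_transform_integral_bound[OF nu v1 v2 v3 HFb]) blast+
    have Re_sq: "Re (z^2 / 4) = (Re z)^2 / 4 - (Im z)^2 / 4" for z
      by (simp add: power2_eq_square diff_divide_distrib)
    have bx: "cmod (\<Phi> (z^2 / 4)) \<le> max C1 C2 * exp ((Re z)^2 / 4 + v \<bar>Im z\<bar>)" for z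
    proof -
      have "cmod (\<Phi> (z^2 / 4)) \<le> exp (Re (z^2 / 4)) * (C1 * exp ((Im z)^2 / 4 + v \<bar>Im z\<bar>))"
        unfolding \<Phi>_def laguerre_transform_def norm_mult norm_exp_eq_Re
        by (intro mult_left_mono C1) auto
      also have "\<dots> = C1 * exp (Re (z^2 / 4) + ((Im z)^2 / 4 + v \<bar>Im z\<bar>))" by (simp only: exp_add mult_ac)
      also have "Re (z^2 / 4) + ((Im z)^2 / 4 + v \<bar>Im z\<bar>) = (Re z)^2 / 4 + v \<bar>Im z\<bar>" unfolding Re_sq by simp
      finally show ?thesis by (rule order_trans) (intro mult_right_mono, auto)
    qed
    have b\<^sub>y: "cmod (\<Phi> (z^2 / 4)) \<le> max C1 C2 * exp ((Im z)^2 / 4 + v \<bar>Re z\<bar>)" for z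
    proof -
      \<comment> \<open>Since -z^2/4 = (iz)^2/4, the Hankel representation is evaluated at iz, whose
        imaginary part is Re z.\<close>
      have "\<Phi> (z^2 / 4) = laguerre_transform \<nu> (hankel \<nu> f) ((\<i> * z)^2 / 4)"
        unfolding \<Phi>_def laguerre_transform_hankel[OF nu Fm Fi, of "z^2 / 4"]
        by (simp add: hank[abs_def] power_mult_distrib)
      then have "cmod (\<Phi> (z^2 / 4)) \<le> exp (Re ((\<i> * z)^2 / 4)) * (C2 * exp ((Im (\<i> * z))^2 / 4 + v \<bar>Im (\<i> * z)\<bar>))"
        unfolding laguerre_transform_def norm_mult[of "exp _"] norm_exp_eq_Re
        by (simp only: norm_mult[of "exp _"] norm_exp_eq_Re) (intro mult_left_mono C2, auto)
      also have "\<dots> = C2 * exp (Re ((\<i> * z)^2 / 4) + ((Im (\<i> * z))^2 / 4 + v \<bar>Im (\<i> * z)\<bar>))" by (simp only: exp_add mult_ac)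
      also have "Re ((\<i> * z)^2 / 4) + ((Im (\<i> * z))^2 / 4 + v \<bar>Im (\<i> * z)\<bar>) = (Im z)^2 / 4 + v \<bar>Re z\<bar>"
        unfolding Re_sq by simp
      finally show ?thesis by (rule order_trans) (intro mult_right_mono, auto)
    qed
    have grv: "v t \<le> D * v x * (t / x) powr a" if "x0 / q \<le> x" "x \<le> t" for x t
    proof -
      have "w (q * t) \<le> D * w (q * x) * (q * t / (q * x)) powr a"
        using that pos by (intro gr) (auto simp: field_simps)
      then have "lam * w (q * t) \<le> lam * (D * w (q * x) * (t / x) powr a)"
        using pos by (intro mult_left_mono) auto
      then show ?thesis by (simp add: v_def mult_ac)
    qed
    have hol: "(\<lambda>z. \<Phi> (z^2 / 4)) holomorphic_on UNIV"
    proof -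
      have "\<Phi> holomorphic_on ball 0 (1 + cmod z)" for z
        using sums by (intro power_series_holomorphic[where a = "\<lambda>k. hinner \<nu> f (laguerre_fun \<nu> k) / of_real (Gamma (real k + \<nu> + 1))"]) auto
      then have "\<Phi> field_differentiable at z" for z
        by (rule holomorphic_on_imp_differentiable_at[of _ "ball 0 (1 + cmod z)"]) auto
      then have "\<Phi> holomorphic_on UNIV" by (auto simp: holomorphic_on_def field_differentiable_at_within)
      moreover have "(\<lambda>z. z^2 / 4 :: complex) holomorphic_on UNIV" by (intro holomorphic_intros) auto
      ultimately show ?thesis
        using holomorphic_on_compose_gen[of "\<lambda>z. z^2 / 4" UNIV \<Phi> UNIV] by (simp add: o_def)
    qed
    obtain B L where BL: "B > 0" "L > 0" "\<And>z. cmod (\<Phi> (z^2 / 4)) \<le> B * exp (L * v (cmod z))"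
      by (rule entire_weight_bound[OF hol bx b\<^sub>y v1 v2 D(1-3) divide_pos_pos[OF D(4) pos(2)] grv]) blast+
    \<comment> \<open>With |z| = exp(u)/q, the exponent L v(|z|) = L \<open>lam\<close> w(exp u) is
      exactly w(exp u)/l.\<close>
    define l where "l = 1 / (L * lam)"
    have l: "l > 0" using BL pos by (simp add: l_def)
    have bound: "cmod (\<Phi> (z^2 / 4)) \<le> B * exp (w (exp u) / l)" if "u \<ge> 0" "cmod z = exp u / q" for u z
      using BL(3)[of z] pos by (simp add: that(2) v_def l_def mult_ac)
    show "\<exists>l>0. \<exists>C>0. \<forall>k::nat.
        ereal (cmod (hinner \<nu> f (laguerre_fun \<nu> k))) \<le>
          ereal (C * 2^(2*k) * Gamma (real k + \<nu> + 1)) *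
          eexp (ereal (2 * real k * ln q) -
                ereal (1/l) * young_conj (\<lambda>t. w (exp t)) (2 * l * real k))"
      by (intro exI[of _ l] exI[of _ B] conjI allI l BL(1)
            laguerre_coefficient_young_bound[OF nu pos(2) l less_imp_le[OF BL(1)] sums bound])
  qed
qed

end
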